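(* Let $d\ge3$, $p\in[0,1)$ and $q_1=0$. Let $S$ and $\tilde S:=\tilde S^{(q_1)}$ be respectively a multi-dimensional elephant random walk (MERW) on $\mathbb{Z}^d$ with parameter $p$ and a $d$-elephant random walk ($d$-ERW) on $\mathbb{Z}^d$ with pair of parameters $(p,q_1)=(p,0)$, defined on the same probability space and coupled as described in the context. Then, for any $\nu\in\left(0,\frac12-\frac1d\right)$, $$\mathbb{E}\left(\sum_{n=1}^\infty\mathbf 1_{\{\|S_n\|\le n^\nu\}}\right)\le\mathbb{E}\left(\sum_{n=1}^\infty\mathbf 1_{\{\|\tilde S_n\|\le n^\nu\}}\right)<\infty ;$$ in particular, almost surely, $\|S_n\|>n^\nu$ for all large $n$.
   Context: $x(i)$ denotes the $i$-th coordinate of a vector $x$, $e_1,\dots,e_d$ is the standard basis of $\mathbb{R}^d$, and $\|\cdot\|$ is the Euclidean norm. MERW on $\mathbb{Z}^d$ with parameter $p\in[0,1]$: $S_0=0$, $S_1=\sigma_1=e_1$. For each $n\ge 1$, choose $n'$ uniformly at random in $\{1,\dots,n\}$ (independently of the past); given the past and $n'$, let $\sigma_{n+1}=\sigma_{n'}$ with probability $p$, and $\sigma_{n+1}=\sigma$ with probability $\frac{1-p}{2d-1}$ for each $\sigma\in\{\pm e_1,\dots,\pm e_d\}\setminus\{\sigma_{n'}\}$. Set $S_{n+1}=S_n+\sigma_{n+1}$. When $d=1$ this is called an elephant random walk (ERW). Let $b_n(i):=\#\{1\le j\le n:\sigma_j\in\{e_i,-e_i\}\}$. $d$-ERW with pair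 of parameters $(p,q)\in[0,1]^2$: a nearest-neighbor walk $(\tilde S_n)_{n\ge0}$ on $\mathbb{Z}^d$ with $\tilde S_0=0$, $\tilde S_1=\tilde\sigma_1=e_1$. For $n\ge1$ let $\tilde b_n(i):=\#\{1\le j\le n:\tilde\sigma_j\in\{e_i,-e_i\}\}$ and $$\tilde c_n(i):=\frac{2dp-1}{2d-1}\frac{\tilde b_n(i)}n+\frac{2-2p}{2d-1},\qquad i=1,\dots,d .$$ Given $\tilde S_0,\dots,\tilde S_n=\tilde x$, the next step $\tilde\sigma_{n+1}$ has conditional law $$\mathbb{P}(\tilde\sigma_{n+1}=\pm e_i)=\tilde c_n(i)\left(\frac12\pm\frac{(2q-1)\tilde x(i)}{2\tilde b_n(i)}\mathbf 1_{\{\tilde b_n(i)\ne0\}}\right),\quad i=1,\dots,d,$$ and $\tilde S_{n+1}=\tilde S_n+\tilde\sigma_{n+1}$. Coupling: for every $p\in[0,1]$ the MERW $S$ with parameter $p$ and the $d$-ERW $\tilde S$ with parameters $(p,0)$ can be constructed on the same probability space so that the following hold, and the pair $(S,\tilde S)$ in the claim is such a coupled pair. (a) The two walks always move along the same axis: for all $n\ge1$ and $i\in\{1,\dots,d\}$, $\sigma_n\in\{e_i,-e_i\}$ if and only if $\tilde\sigma_n\in\{e_i,-e_i\}$; equivalently $b_n(i)=\tilde b_n(i)$. (b) For any $n\ge1$, conditionally on $\{b_m(i)\}_{1\le i\le d,\,1\le m\le n}=\{a_m(i)\}_{1\le i\le d,\,1\le m\le n}$, the sequence $(\tilde S_m)_{1\le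 m\le n}$ has the law of $\left((X^{(1)}_{a_m(1)},\dots,X^{(d)}_{a_m(d)})\right)_{1\le m\le n}$, where $X^{(1)},\dots,X^{(d)}$ are independent one-dimensional ERWs with common parameter $0$, with $X^{(1)}_1=1$ and, for $i\ne1$, $X^{(i)}_1$ equal to $\pm1$ with probability $\frac12$ each. (c) $|\tilde S_n(i)|\le|S_n(i)|$ for all $i\in\{1,\dots,d\}$ and all $n\ge0$. *)

theory Defs
  imports "HOL-Probability.Probability"
begin

text \<open>
  The lattice \<open>\<int>\<^sup>d\<close> is viewed inside \<open>real ^ 'd\<close> with \<open>d = CARD('d)\<close>, so that \<open>norm\<close> is the
  Euclidean norm. A finite index type has no canonical first element, so the coordinate playing
  the role of \<open>1\<close> (the direction of the first step) is an explicit parameter \<open>k :: 'd\<close>.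
  Deterministic trajectories are functions \<open>x :: nat \<Rightarrow> real ^ 'd\<close>.
\<close>

definition axis_steps :: "'d::finite \<Rightarrow> (real ^ 'd) set" where
  "axis_steps i = {axis i 1, - axis i 1}"

definition unit_steps :: "(real ^ 'd::finite) set" where
  "unit_steps = (\<Union>i. axis_steps i)"

definition step :: "(nat \<Rightarrow> real ^ 'd::finite) \<Rightarrow> nat \<Rightarrow> real ^ 'd" where
  "step x n = x n - x (n - 1)"

definition axis_count :: "(nat \<Rightarrow> real ^ 'd::finite) \<Rightarrow> nat \<Rightarrow> 'd \<Rightarrow> nat" where
  "axis_count x n i = card {j \<in> {1..n}. step x j \<in> axis_steps i}"

text \<open>The law of the step \<open>\<sigma>\<^sub>n\<^sub>+\<^sub>1\<close> of the MERW, given that the walk followed \<open>x\<close> up to time \<open>n \<ge> 1\<close>.\<close>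

definition merw_next :: "real \<Rightarrow> (nat \<Rightarrow> real ^ 'd::finite) \<Rightarrow> nat \<Rightarrow> (real ^ 'd) pmf" where
  "merw_next p x n =
     do {
       n' \<leftarrow> pmf_of_set {1..n};
       repeat \<leftarrow> bernoulli_pmf p;
       if repeat then return_pmf (step x n') else pmf_of_set (unit_steps - {step x n'})
     }"

definition is_merw ::
  "'w measure \<Rightarrow> 'd::finite \<Rightarrow> real \<Rightarrow> (nat \<Rightarrow> 'w \<Rightarrow> real ^ 'd) \<Rightarrow> bool" where
  "is_merw M k p S \<longleftrightarrow>
     (\<forall>n. S n \<in> borel_measurable M) \<and>
     (AE \<omega> in M. S 0 \<omega> = 0 \<and> S 1 \<omega> = axis k 1) \<and>
     (\<forall>n\<ge>1. \<forall>x. \<P>(\<omega> in M. \<forall>j\<le>n. S j \<omega> = x j) > 0 \<longrightarrow>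
        (\<forall>v. \<P>(\<omega> in M. S (n + 1) \<omega> - S n \<omega> = v \<bar> \<forall>j\<le>n. S j \<omega> = x j) =
             pmf (merw_next p x n) v))"

definition derw_axis_prob :: "real \<Rightarrow> (nat \<Rightarrow> real ^ 'd::finite) \<Rightarrow> nat \<Rightarrow> 'd \<Rightarrow> real" where
  "derw_axis_prob p x n i =
     (2 * real CARD('d) * p - 1) / (2 * real CARD('d) - 1) * (real (axis_count x n i) / real n)
     + (2 - 2 * p) / (2 * real CARD('d) - 1)"

definition derw_bias :: "real \<Rightarrow> (nat \<Rightarrow> real ^ 'd::finite) \<Rightarrow> nat \<Rightarrow> 'd \<Rightarrow> real" where
  "derw_bias q x n i =
     (if axis_count x n i \<noteq> 0
      then (2 * q - 1) * (x n $ i) / (2 * real (axis_count x n i)) else 0)"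

definition is_derw ::
  "'w measure \<Rightarrow> 'd::finite \<Rightarrow> real \<Rightarrow> real \<Rightarrow> (nat \<Rightarrow> 'w \<Rightarrow> real ^ 'd) \<Rightarrow> bool" where
  "is_derw M k p q S \<longleftrightarrow>
     (\<forall>n. S n \<in> borel_measurable M) \<and>
     (AE \<omega> in M. S 0 \<omega> = 0 \<and> S 1 \<omega> = axis k 1) \<and>
     (\<forall>n\<ge>1. \<forall>x. \<P>(\<omega> in M. \<forall>j\<le>n. S j \<omega> = x j) > 0 \<longrightarrow>
        (\<forall>i. \<P>(\<omega> in M. S (n + 1) \<omega> - S n \<omega> = axis i 1 \<bar> \<forall>j\<le>n. S j \<omega> = x j) =
               derw_axis_prob p x n i * (1 / 2 + derw_bias q x n i) \<and>
             \<P>(\<omega> in M. S (n + 1) \<omega> - S n \<omega> = - axis i 1 \<bar> \<forall>j\<le>n. S j \<omega> = x j) =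
               derw_axis_prob p x n i * (1 / 2 - derw_bias q x n i)))"

text \<open>
  The law, on trajectory space, of the MERW stopped at time \<open>n\<close>, started from \<open>0\<close> and with first
  step of law \<open>init\<close>. For the index type \<open>1\<close> this is the one-dimensional ERW.
\<close>

primrec merw_walk ::
  "(real ^ 'd::finite) pmf \<Rightarrow> real \<Rightarrow> nat \<Rightarrow> (nat \<Rightarrow> real ^ 'd) pmf" where
  "merw_walk init p 0 = return_pmf (\<lambda>_. 0)"
| "merw_walk init p (Suc n) =
     do {
       x \<leftarrow> merw_walk init p n;
       v \<leftarrow> (if n = 0 then init else merw_next p x n);
       return_pmf (\<lambda>j. if j \<le> n then x j else x n + v)
     }"

text \<open>
  The joint law of independent ERWs \<open>X\<^sup>(\<^sup>i\<^sup>)\<close> with parameter \<open>q\<close>, up to time \<open>n\<close>: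
  \<open>X\<^sup>(\<^sup>k\<^sup>)\<close> starts with \<open>+1\<close>, the others with a uniform sign.
\<close>

definition indep_erws :: "'d::finite \<Rightarrow> real \<Rightarrow> nat \<Rightarrow> ('d \<Rightarrow> nat \<Rightarrow> real ^ 1) pmf" where
  "indep_erws k q n =
     Pi_pmf UNIV (\<lambda>_. 0)
       (\<lambda>i. merw_walk (if i = k then return_pmf (axis 1 1) else pmf_of_set unit_steps) q n)"

text \<open>
  The clauses (same axis, conditional law of \<open>T\<close> given the axis counts, domination) of the coupling
  of the MERW \<open>S\<close> with the \<open>d\<close>-ERW \<open>T\<close> with second parameter \<open>0\<close>. In the second one, the time
  change only looks at the ERWs at times \<open>a m i \<le> m \<le> n\<close>. All laws involved there are
  discrete, so they are compared on single trajectories \<open>y\<close>.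
\<close>

definition coupled ::
  "'w measure \<Rightarrow> 'd::finite \<Rightarrow> (nat \<Rightarrow> 'w \<Rightarrow> real ^ 'd) \<Rightarrow> (nat \<Rightarrow> 'w \<Rightarrow> real ^ 'd) \<Rightarrow> bool" where
  "coupled M k S T \<longleftrightarrow>
     (AE \<omega> in M. \<forall>n\<ge>1. \<forall>i.
        step (\<lambda>j. S j \<omega>) n \<in> axis_steps i \<longleftrightarrow> step (\<lambda>j. T j \<omega>) n \<in> axis_steps i) \<and>
     (\<forall>n\<ge>1. \<forall>a.
        \<P>(\<omega> in M. \<forall>m\<in>{1..n}. \<forall>i. axis_count (\<lambda>j. S j \<omega>) m i = a m i) > 0 \<longrightarrow>
        (\<forall>y. \<P>(\<omega> in M. (\<forall>m\<in>{1..n}. T m \<omega> = y m)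
                 \<bar> \<forall>m\<in>{1..n}. \<forall>i. axis_count (\<lambda>j. S j \<omega>) m i = a m i) =
             measure_pmf.prob (indep_erws k 0 n)
               {X. \<forall>m\<in>{1..n}. (\<chi> i. X i (a m i) $ 1) = y m})) \<and>
     (AE \<omega> in M. \<forall>n i. \<bar>T n \<omega> $ i\<bar> \<le> \<bar>S n \<omega> $ i\<bar>)"

end

theory Submission
  imports Defs
begin

text \<open>
  The domination \<open>\<bar>T\<^sub>n(i)\<bar> \<le> \<bar>S\<^sub>n(i)\<bar>\<close> gives the first inequality at once, and a finite expected number of
  visits forces almost surely finitely many of them. So everything rests on showing that
  \<open>\<P>(\<parallel>T\<^sub>n\<parallel> \<le> n\<^sup>\<nu>)\<close> is summable, which follows from two estimates.

  First, every axis is used linearly often. Whatever the past, the next step of the MERW lies on a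
  given axis with probability at least \<open>(1 - p) / (2 d)\<close>, because a refused repetition leads to a
  uniform choice among at most \<open>2 d\<close> steps (\<open>merw_next_axis_prob_ge\<close>). Hence
  \<open>\<E>(2\<^sup>-\<^sup>b)\<close>, for \<open>b\<close> the number of steps along the axis, decays exponentially in \<open>n\<close>
  (\<open>axis_count_exp_moment\<close>), and the axis counts drop below \<open>\<delta> n\<close> only with
  exponentially small probability.

  Second, a one-dimensional ERW \<open>X\<close> with parameter \<open>0\<close> satisfies \<open>\<P>(X\<^sub>m = x) \<le> 7 / \<surd>m\<close> for all \<open>x\<close>. It
  always reverses a uniformly chosen earlier step, so its number of up-steps follows the
  recurrence of the Eulerian numbers: for \<open>m \<ge> 2\<close> it is distributed like one plus the number of descents
  of a uniform random permutation of \<open>m - 1\<close> letters (\<open>erw_prob_eq_eulerian\<close>). The Eulerian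
  distribution is log-concave (\<open>eulerian_prob_log_concave\<close>) and has variance \<open>m / 12\<close> for \<open>m \<ge> 3\<close>
  (\<open>eulerian_prob_variance\<close>). A log-concave distribution with a point of mass \<open>c\<close> has second
  moment at most \<open>4 / c\<^sup>2\<close> about this point (\<open>submult_seq_second_moment\<close> on either side), while the
  variance bounds this moment from below. Therefore \<open>c\<close> is of order at most \<open>1 / \<surd>m\<close>
  (\<open>eulerian_prob_le\<close>).

  Given axis counts that are all at least \<open>\<delta> n\<close>, the coordinates of \<open>T\<^sub>n\<close> are values of independent such
  walks at these times.
  The probability that all of them are at most \<open>n\<^sup>\<nu>\<close> in absolute value is thus of order
  \<open>(n\<^sup>\<nu> / \<surd>n)\<^sup>d\<close>, which is summable exactly because \<open>\<nu> < 1/2 - 1/d\<close>.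
\<close>

section \<open>Moments of log-concave sequences\<close>

text \<open>
  The hypothesis says that \<open>c / c\<^sub>0\<close> is submultiplicative. Multiplying the right-hand side by the total
  mass \<open>\<Sum> c\<^sub>l \<le> 1\<close> and using \<open>c\<^sub>i c\<^sub>l \<ge> c\<^sub>0 c\<^sub>i\<^sub>+\<^sub>l\<close> replaces the weight \<open>w\<close> by its partial sums, at the cost
  of one factor \<open>c\<^sub>0\<close>. Iterating this from a constant weight bounds polynomial moments of any order.
\<close>

lemma submult_seq_weighted_sum:
  fixes c w :: "nat \<Rightarrow> real"
  assumes nonneg: "\<And>i. c i \<ge> 0" "\<And>i. w i \<ge> 0"
    and submult: "\<And>i j. c 0 * c (i + j) \<le> c i * c j"
    and total: "(\<Sum>i\<le>N. c i) \<le> 1"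
  shows "c 0 * (\<Sum>j\<le>N. c j * (\<Sum>i\<le>j. w i)) \<le> (\<Sum>i\<le>N. w i * c i)"
proof -
  have "c 0 * (\<Sum>j\<le>N. c j * (\<Sum>i\<le>j. w i)) = (\<Sum>j\<le>N. \<Sum>i\<le>j. w i * (c 0 * c (i + (j - i))))"
    by (simp add: sum_distrib_left mult_ac)
  also have "\<dots> \<le> (\<Sum>j\<le>N. \<Sum>i\<le>j. w i * (c i * c (j - i)))"
    by (intro sum_mono mult_left_mono submult nonneg)
  also have "\<dots> = (\<Sum>(i, l) \<in> {(i, l). i + l \<le> N}. w i * (c i * c l))"
    using sum.triangle_reindex_eq[of "\<lambda>i l. w i * (c i * c l)" N] by simp
  also have "\<dots> \<le> (\<Sum>(i, l) \<in> {..N} \<times> {..N}. w i * (c i * c l))"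
    by (rule sum_mono2) (auto intro!: nonneg mult_nonneg_nonneg)
  also have "\<dots> = (\<Sum>i\<le>N. w i * c i) * (\<Sum>l\<le>N. c l)"
    by (simp add: sum_product sum.cartesian_product mult.assoc)
  also have "\<dots> \<le> (\<Sum>i\<le>N. w i * c i) * 1"
    by (intro mult_left_mono total sum_nonneg mult_nonneg_nonneg nonneg)
  finally show ?thesis by simp
qed

text \<open>
  The geometric sequence \<open>c\<^sub>i = q (1 - q)\<^sup>i\<close> has second moment \<open>(1 - q) (2 - q) / q\<^sup>2\<close>, so the
  constant \<open>2\<close> is optimal.
  Two rounds of the previous lemma take the weight from \<open>1\<close> to \<open>i + 1\<close> and then to
  \<open>(i + 1) (i + 2) / 2\<close>.
\<close>

lemma submult_seq_second_moment:
  fixes c :: "nat \<Rightarrow> real"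
  assumes nonneg: "\<And>i. c i \<ge> 0"
    and submult: "\<And>i j. c 0 * c (i + j) \<le> c i * c j"
    and total: "(\<Sum>i\<le>N. c i) \<le> 1"
  shows "(c 0)\<^sup>2 * (\<Sum>i\<le>N. (real i)\<^sup>2 * c i) \<le> 2"
proof -
  have first: "c 0 * (\<Sum>j\<le>N. c j * (real j + 1)) \<le> 1"
    using submult_seq_weighted_sum[of c "\<lambda>_. 1" N, OF nonneg _ submult total] total
    by (simp add: add.commute)
  have gauss: "(\<Sum>i\<le>j. real i + 1) = (real j + 1) * (real j + 2) / 2" for j
    by (induction j) (simp_all add: field_simps)
  have second: "c 0 * (\<Sum>j\<le>N. c j * ((real j + 1) * (real j + 2) / 2)) \<le> (\<Sum>j\<le>N. (real j + 1) * c j)"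
    using submult_seq_weighted_sum[of c "\<lambda>i. real i + 1" N, OF nonneg _ submult total]
    by (simp only: gauss)
  have "(\<Sum>i\<le>N. (real i)\<^sup>2 * c i) \<le> 2 * (\<Sum>j\<le>N. c j * ((real j + 1) * (real j + 2) / 2))"
    unfolding sum_distrib_left
  proof (rule sum_mono)
    fix i
    have "(real i)\<^sup>2 * c i \<le> ((real i + 1) * (real i + 2)) * c i"
      by (intro mult_right_mono nonneg) (simp add: power2_eq_square algebra_simps)
    then show "(real i)\<^sup>2 * c i \<le> 2 * (c i * ((real i + 1) * (real i + 2) / 2))"
      by (simp add: mult_ac)
  qed
  then have "(c 0)\<^sup>2 * (\<Sum>i\<le>N. (real i)\<^sup>2 * c i)
      \<le> (c 0)\<^sup>2 * (2 * (\<Sum>j\<le>N. c j * ((real j + 1) * (real j + 2) / 2)))"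
    by (intro mult_left_mono) auto
  also have "\<dots> = 2 * c 0 * (c 0 * (\<Sum>j\<le>N. c j * ((real j + 1) * (real j + 2) / 2)))"
    by (simp add: power2_eq_square)
  also have "\<dots> \<le> 2 * c 0 * (\<Sum>j\<le>N. (real j + 1) * c j)"
    by (intro mult_left_mono second) (simp add: nonneg)
  also have "\<dots> = 2 * (c 0 * (\<Sum>j\<le>N. c j * (real j + 1)))"
    by (simp add: mult_ac)
  also have "\<dots> \<le> 2"
    using first by simp
  finally show ?thesis .
qed

text \<open>
  Log-concavity says that the ratios \<open>c\<^sub>i\<^sub>+\<^sub>1 / c\<^sub>i\<close> decrease. Then \<open>c\<^sub>i\<^sub>+\<^sub>j / c\<^sub>j\<close>, a product of \<open>i\<close> later
  ratios, is at most \<open>c\<^sub>i / c\<^sub>0\<close>. The condition on zeros excludes gaps in the support, across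
  which the ratios would carry no information.
\<close>

lemma log_concave_imp_submult:
  fixes c :: "nat \<Rightarrow> real"
  assumes nonneg: "\<And>i. c i \<ge> 0"
    and log_concave: "\<And>i. c i * c (i + 2) \<le> (c (i + 1))\<^sup>2"
    and zero: "\<And>i. c i = 0 \<Longrightarrow> c (Suc i) = 0"
  shows "c 0 * c (i + j) \<le> c i * c j"
proof -
  have ratio: "c i * c (Suc (i + k)) \<le> c (Suc i) * c (i + k)" for i k
  proof (induction k)
    case (Suc k)
    show ?case
    proof (cases "c (i + k) = 0")
      case True
      then have "c (Suc (i + Suc k)) = 0" using zero by simp
      then show ?thesis by (simp add: nonneg)
    next
      case False
      have "c (i + k) * (c i * c (Suc (i + Suc k))) = c i * (c (i + k) * c (i + k + 2))"
        by (simp add: mult_ac numeral_2_eq_2)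
      also have "\<dots> \<le> c i * (c (i + k + 1))\<^sup>2"
        by (intro mult_left_mono log_concave nonneg)
      also have "\<dots> = (c i * c (Suc (i + k))) * c (Suc (i + k))"
        by (simp add: power2_eq_square)
      also have "\<dots> \<le> (c (Suc i) * c (i + k)) * c (Suc (i + k))"
        by (intro mult_right_mono Suc.IH nonneg)
      also have "\<dots> = c (i + k) * (c (Suc i) * c (i + Suc k))"
        by (simp add: mult_ac)
      finally show ?thesis
        using False nonneg[of "i + k"] by (simp add: mult_le_cancel_left)
    qed
  qed simp
  show ?thesis
  proof (induction i)
    case (Suc i)
    show ?case
    proof (cases "c i = 0")
      case True
      have "c (i + k) = 0" for k
        by (induction k) (use True zero in auto)
      from this[of "Suc j"] show ?thesis by (simp add: nonneg)
    next
      case False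
      have "c i * (c 0 * c (Suc i + j)) = c 0 * (c i * c (Suc (i + j)))" by simp
      also have "\<dots> \<le> c 0 * (c (Suc i) * c (i + j))"
        by (intro mult_left_mono ratio nonneg)
      also have "\<dots> = c (Suc i) * (c 0 * c (i + j))" by simp
      also have "\<dots> \<le> c (Suc i) * (c i * c j)"
        by (intro mult_left_mono Suc.IH nonneg)
      also have "\<dots> = c i * (c (Suc i) * c j)" by simp
      finally show ?thesis
        using False nonneg[of i] by (simp add: mult_le_cancel_left)
    qed
  qed simp
qed

section \<open>The Eulerian distribution\<close>

text \<open>
  The probability that a uniform random permutation of \<open>n\<close> letters has \<open>k\<close> descents, that is, the
  Eulerian number \<open>A(n, k) / n!\<close>: the letter \<open>n + 1\<close> preserves the number of descents in \<open>k + 1\<close> of the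
  \<open>n + 1\<close> possible places and raises it by one in the others. The argument \<open>k\<close> is an integer, so that
  shifts to either side of the support need no case distinction.
\<close>

primrec eulerian_prob :: "nat \<Rightarrow> int \<Rightarrow> real" where
  "eulerian_prob 0 k = (if k = 0 then 1 else 0)"
| "eulerian_prob (Suc n) k =
     ((k + 1) * eulerian_prob n k + (n + 1 - k) * eulerian_prob n (k - 1)) / (n + 1)"

declare eulerian_prob.simps(2) [simp del]

lemmas eulerian_prob_Suc = eulerian_prob.simps(2)

lemma eulerian_prob_eq_0: "k < 0 \<or> k > int n \<Longrightarrow> eulerian_prob n k = 0"
proof (induction n arbitrary: k)
  case (Suc n)
  have "eulerian_prob n k = 0"
    using Suc.prems by (intro Suc.IH) auto
  moreover have "real_of_int (int n + 1 - k) * eulerian_prob n (k - 1) = 0"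
  proof (cases "k < 0 \<or> k - 1 > int n")
    case True
    then have "eulerian_prob n (k - 1) = 0" by (intro Suc.IH) auto
    then show ?thesis by simp
  next
    case False
    then show ?thesis using Suc.prems by auto
  qed
  ultimately show ?case by (simp add: eulerian_prob_Suc)
qed auto

lemma eulerian_prob_Suc_eq_0: "k < 0 \<or> k > int n \<Longrightarrow> eulerian_prob (Suc n) k = 0"
  by (cases "k = int n + 1") (auto simp: eulerian_prob_Suc eulerian_prob_eq_0)

lemma eulerian_prob_Suc_pos: "0 \<le> k \<Longrightarrow> k \<le> int n \<Longrightarrow> eulerian_prob (Suc n) k > 0"
proof (induction n arbitrary: k)
  case (Suc n)
  have nonneg: "eulerian_prob (Suc n) j \<ge> 0" for j
    using Suc.IH[of j] eulerian_prob_Suc_eq_0[of j n] by (cases "0 \<le> j \<and> j \<le> int n") auto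
  have "(real_of_int k + 1) * eulerian_prob (Suc n) k > 0 \<or> k = int n + 1"
    using Suc.prems Suc.IH[of k] by auto
  moreover have "(real (Suc n) + 1 - real_of_int k) * eulerian_prob (Suc n) (k - 1) > 0 \<or> k = 0"
    using Suc.prems Suc.IH[of "k - 1"] by auto
  moreover have "(real_of_int k + 1) * eulerian_prob (Suc n) k \<ge> 0"
    "(real (Suc n) + 1 - real_of_int k) * eulerian_prob (Suc n) (k - 1) \<ge> 0"
    using Suc.prems nonneg by auto
  ultimately have "(real_of_int k + 1) * eulerian_prob (Suc n) k
      + (real (Suc n) + 1 - real_of_int k) * eulerian_prob (Suc n) (k - 1) > 0"
    by (smt (verit) of_nat_0_le_iff)
  then show ?case
    by (subst eulerian_prob_Suc) (simp add: zero_less_divide_iff)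
qed (simp add: eulerian_prob_Suc)

lemma eulerian_prob_nonneg: "eulerian_prob n k \<ge> 0"
proof (cases n)
  case (Suc m)
  then show ?thesis
    using eulerian_prob_Suc_pos[of k m] eulerian_prob_Suc_eq_0[of k m]
    by (cases "0 \<le> k \<and> k \<le> int m") (auto)
qed auto

text \<open>
  In the induction step, write \<open>x = k + 1\<close>, \<open>y = n + 1 - k\<close> and \<open>a\<close> for the distribution at \<open>n\<close>. Expanding
  the product of the two neighbours and estimating each of its four terms by log-concavity of \<open>a\<close>
  leaves exactly \<open>(x a\<^sub>k + y a\<^sub>k\<^sub>-\<^sub>1)\<^sup>2 - (a\<^sub>k - a\<^sub>k\<^sub>-\<^sub>1)\<^sup>2\<close>.
\<close>

lemma eulerian_prob_log_concave:
  "eulerian_prob n (k - 1) * eulerian_prob n (k + 1) \<le> (eulerian_prob n k)\<^sup>2"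
proof (induction n arbitrary: k)
  case (Suc n)
  define a where "a = eulerian_prob n"
  have lc: "a (j - 1) * a (j + 1) \<le> (a j)\<^sup>2" for j
    using Suc.IH by (simp add: a_def)
  have nonneg: "a j \<ge> 0" for j
    by (simp add: a_def eulerian_prob_nonneg)
  have gap2: "a (k - 2) * a (k + 1) \<le> a (k - 1) * a k"
  proof (cases "a (k - 1) * a k = 0")
    case True
    have "a (k - 2) * a (k + 1) = 0"
    proof (cases n)
      case 0
      then show ?thesis by (simp add: a_def)
    next
      case (Suc m)
      then show ?thesis
        using True eulerian_prob_Suc_pos[of "k - 1" m] eulerian_prob_Suc_pos[of k m]
          eulerian_prob_Suc_eq_0[of "k - 2" m] eulerian_prob_Suc_eq_0[of "k + 1" m]
        unfolding a_def by (smt (verit) mult_eq_0_iff)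
    qed
    moreover have "0 \<le> a (k - 1) * a k" by (simp add: nonneg)
    ultimately show ?thesis by linarith
  next
    case False
    then have pos: "a (k - 1) * a k > 0"
      using nonneg by (simp add: less_le)
    have "(a (k - 1) * a k) * (a (k - 2) * a (k + 1))
        = (a (k - 2) * a k) * (a (k - 1) * a (k + 1))" by simp
    also have "\<dots> \<le> (a (k - 1))\<^sup>2 * (a k)\<^sup>2"
      using lc[of "k - 1"] lc[of k] nonneg by (intro mult_mono) auto
    also have "\<dots> = (a (k - 1) * a k) * (a (k - 1) * a k)"
      by (simp add: power2_eq_square)
    finally show ?thesis using pos by (simp add: mult_le_cancel_left)
  qed
  show ?case
  proof (cases "0 \<le> k \<and> k \<le> int n")
    case False
    then have "eulerian_prob (Suc n) (k - 1) * eulerian_prob (Suc n) (k + 1) = 0"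
      using eulerian_prob_Suc_eq_0[of "k - 1" n] eulerian_prob_Suc_eq_0[of "k + 1" n]
      by (auto)
    then show ?thesis by (metis zero_le_power2)
  next
    case True
    define x where "x = real_of_int k + 1"
    define y where "y = real n + 1 - real_of_int k"
    have "x \<ge> 1" using True by (simp add: x_def)
    moreover have "y \<ge> 1" using True unfolding y_def by linarith
    ultimately have xy: "x \<ge> 1" "y \<ge> 1" .
    have "((x - 1) * a (k - 1) + (y + 1) * a (k - 2)) * ((x + 1) * a (k + 1) + (y - 1) * a k)
        = (x\<^sup>2 - 1) * (a (k - 1) * a (k + 1)) + (x - 1) * (y - 1) * (a (k - 1) * a k)
          + (x + 1) * (y + 1) * (a (k - 2) * a (k + 1)) + (y\<^sup>2 - 1) * (a (k - 2) * a k)"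
      by (simp add: algebra_simps power2_eq_square)
    also have "\<dots> \<le> (x\<^sup>2 - 1) * (a k)\<^sup>2 + (x - 1) * (y - 1) * (a (k - 1) * a k)
          + (x + 1) * (y + 1) * (a (k - 1) * a k) + (y\<^sup>2 - 1) * (a (k - 1))\<^sup>2"
      using xy lc[of k] lc[of "k - 1"] gap2
      by (intro add_mono mult_left_mono order_refl) (auto simp: one_le_power)
    also have "\<dots> = (x * a k + y * a (k - 1))\<^sup>2 - (a k - a (k - 1))\<^sup>2"
      by (simp add: algebra_simps power2_eq_square)
    also have "\<dots> \<le> (x * a k + y * a (k - 1))\<^sup>2"
      by simp
    finally have main: "((x - 1) * a (k - 1) + (y + 1) * a (k - 2))
        * ((x + 1) * a (k + 1) + (y - 1) * a k) \<le> (x * a k + y * a (k - 1))\<^sup>2" .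
    have e1: "eulerian_prob (Suc n) (k - 1) = ((x - 1) * a (k - 1) + (y + 1) * a (k - 2)) / (n + 1)"
      "eulerian_prob (Suc n) (k + 1) = ((x + 1) * a (k + 1) + (y - 1) * a k) / (n + 1)"
      "eulerian_prob (Suc n) k = (x * a k + y * a (k - 1)) / (n + 1)"
      by (simp_all add: eulerian_prob_Suc a_def x_def y_def algebra_simps)
    show ?thesis
      unfolding e1 times_divide_times_eq power_divide
      using main by (simp add: divide_right_mono power2_eq_square)
  qed
qed auto

text \<open>
  The recurrence in its probabilistic form: from \<open>k\<close> descents the next number is \<open>k\<close> or \<open>k + 1\<close>, with
  weights \<open>k + 1\<close> and \<open>n - k\<close>. All moments below come from it by choosing \<open>f\<close>.
\<close>

lemma eulerian_prob_sum_Suc: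
  fixes f :: "int \<Rightarrow> real"
  shows "(\<Sum>k\<in>{0..int (Suc n)}. f k * eulerian_prob (Suc n) k)
     = (\<Sum>k\<in>{0..int n}. ((k + 1) * f k + (n - k) * f (k + 1)) * eulerian_prob n k) / (n + 1)"
proof -
  have "(\<Sum>k\<in>{0..int (Suc n)}. f k * eulerian_prob (Suc n) k)
      = ((\<Sum>k\<in>{0..int n + 1}. (k + 1) * f k * eulerian_prob n k)
        + (\<Sum>k\<in>{0..int n + 1}. (n + 1 - k) * f k * eulerian_prob n (k - 1))) / (n + 1)"
    by (simp add: eulerian_prob_Suc sum.distrib[symmetric] sum_divide_distrib algebra_simps)
  also have "(\<Sum>k\<in>{0..int n + 1}. (k + 1) * f k * eulerian_prob n k)
      = (\<Sum>k\<in>{0..int n}. (k + 1) * f k * eulerian_prob n k)"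
    by (rule sum.mono_neutral_right) (auto simp: eulerian_prob_eq_0)
  also have "(\<Sum>k\<in>{0..int n + 1}. (n + 1 - k) * f k * eulerian_prob n (k - 1))
      = (\<Sum>k\<in>{1..int n + 1}. (n + 1 - k) * f k * eulerian_prob n (k - 1))"
    by (rule sum.mono_neutral_right) (auto simp: eulerian_prob_eq_0)
  also have "\<dots> = (\<Sum>k\<in>{0..int n}. (n - k) * f (k + 1) * eulerian_prob n k)"
    by (rule sum.reindex_bij_witness[of _ "\<lambda>k. k + 1" "\<lambda>k. k - 1"]) auto
  finally show ?thesis
    by (simp add: sum.distrib[symmetric] algebra_simps)
qed

lemma eulerian_prob_sum: "(\<Sum>k\<in>{0..int n}. eulerian_prob n k) = 1"
proof (induction n)
  case (Suc n)
  have "(\<Sum>k\<in>{0..int (Suc n)}. eulerian_prob (Suc n) k)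
      = (\<Sum>k\<in>{0..int n}. (real n + 1) * eulerian_prob n k) / (n + 1)"
    using eulerian_prob_sum_Suc[of "\<lambda>_. 1" n] by (simp del: eulerian_prob.simps add: add.commute)
  also have "\<dots> = 1"
    by (simp only: sum_distrib_left[symmetric] Suc.IH) simp
  finally show ?case .
qed auto

lemma eulerian_prob_sum_le_1:
  assumes "finite A"
  shows "(\<Sum>k\<in>A. eulerian_prob n k) \<le> 1"
proof -
  have "(\<Sum>k\<in>A. eulerian_prob n k) = (\<Sum>k\<in>A \<inter> {0..int n}. eulerian_prob n k)"
    using assms by (intro sum.mono_neutral_right) (auto simp: not_le eulerian_prob_eq_0)
  also have "\<dots> \<le> (\<Sum>k\<in>{0..int n}. eulerian_prob n k)"
    by (intro sum_mono2) (auto simp: eulerian_prob_nonneg)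
  finally show ?thesis by (simp add: eulerian_prob_sum)
qed

text \<open>
  The conditional mean of the centred variable shrinks by the factor \<open>n / (n + 1)\<close> when \<open>n\<close> letters
  become \<open>n + 1\<close>; a single letter is already centred.
\<close>

lemma eulerian_prob_mean:
  "(\<Sum>k\<in>{0..int (Suc n)}. (2 * real_of_int k - real n) * eulerian_prob (Suc n) k) = 0"
proof (induction n)
  case 0
  have "{0..int (Suc 0)} = {0, 1}" by auto
  then show ?case by (simp add: eulerian_prob_Suc)
next
  case (Suc n)
  have "(\<Sum>k\<in>{0..int (Suc (Suc n))}. (2 * real_of_int k - real (Suc n)) * eulerian_prob (Suc (Suc n)) k)
      = (\<Sum>k\<in>{0..int (Suc n)}. (real n + 1) * ((2 * real_of_int k - real n) * eulerian_prob (Suc n) k))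
        / (real (Suc n) + 1)"
    by (subst eulerian_prob_sum_Suc, rule arg_cong2[of _ _ _ _ "(/)"])
      (auto intro!: sum.cong simp: algebra_simps)
  also have "\<dots> = 0"
    unfolding sum_distrib_left[symmetric] Suc.IH by simp
  finally show ?case .
qed

text \<open>
  Centred and doubled, the number of descents moves by \<open>\<plusminus>1\<close> with a drift towards the centre, so its second
  moment obeys \<open>v' = (1 - 2 / (m + 1)) v + 1\<close> when \<open>m\<close> letters become \<open>m + 1\<close>. The linear solution
  \<open>v = (m + 1) / 3\<close> is attained from \<open>m = 2\<close> on.
\<close>

lemma eulerian_prob_variance:
  "(\<Sum>k\<in>{0..int (Suc (Suc n))}. (2 * real_of_int k - (real n + 1))\<^sup>2 * eulerian_prob (Suc (Suc n)) k)
     = (real n + 3) / 3"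
proof (induction n)
  case 0
  have "{0..int (Suc (Suc 0))} = {0, 1, 2}" by auto
  then show ?case by (simp add: eulerian_prob_Suc)
next
  case (Suc n)
  have "(\<Sum>k\<in>{0..int (Suc (Suc (Suc n)))}. (2 * real_of_int k - (real (Suc n) + 1))\<^sup>2
          * eulerian_prob (Suc (Suc (Suc n))) k)
      = (\<Sum>k\<in>{0..int (Suc (Suc n))}.
          (real n + 1) * ((2 * real_of_int k - (real n + 1))\<^sup>2 * eulerian_prob (Suc (Suc n)) k)
          + (real n + 3) * eulerian_prob (Suc (Suc n)) k) / (real (Suc (Suc n)) + 1)"
    by (subst eulerian_prob_sum_Suc, rule arg_cong2[of _ _ _ _ "(/)"])
      (auto intro!: sum.cong simp: algebra_simps power2_eq_square)
  also have "\<dots> = ((real n + 1) * ((real n + 3) / 3) + (real n + 3) * 1) / (real (Suc (Suc n)) + 1)"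
    unfolding sum.distrib sum_distrib_left[symmetric] Suc.IH eulerian_prob_sum by simp
  also have "\<dots> = (real (Suc n) + 3) / 3"
    by (simp add: field_simps)
  finally show ?case .
qed

lemma eulerian_prob_second_moment_ge:
  fixes x :: real
  shows "(real n + 3) / 12
    \<le> (\<Sum>k\<in>{0..int (Suc (Suc n))}. (real_of_int k - x)\<^sup>2 * eulerian_prob (Suc (Suc n)) k)"
proof -
  let ?m = "(real n + 1) / 2"
  have "(\<Sum>k\<in>{0..int (Suc (Suc n))}. (real_of_int k - x)\<^sup>2 * eulerian_prob (Suc (Suc n)) k)
     = (\<Sum>k\<in>{0..int (Suc (Suc n))}.
        1 / 4 * ((2 * real_of_int k - (real n + 1))\<^sup>2 * eulerian_prob (Suc (Suc n)) k)
        + (?m - x) * ((2 * real_of_int k - real (Suc n)) * eulerian_prob (Suc (Suc n)) k)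
        + (?m - x)\<^sup>2 * eulerian_prob (Suc (Suc n)) k)"
    by (intro sum.cong) (auto simp: field_simps power2_eq_square)
  also have "\<dots> = 1 / 4 * ((real n + 3) / 3) + (?m - x) * 0 + (?m - x)\<^sup>2 * 1"
    unfolding sum.distrib sum_distrib_left[symmetric] eulerian_prob_variance eulerian_prob_sum
      eulerian_prob_mean ..
  also have "\<dots> \<ge> (real n + 3) / 12"
    by simp
  finally show ?thesis .
qed

text \<open>
  If the point \<open>k\<close> has mass \<open>M\<close>, each side contributes at most \<open>2 / M\<^sup>2\<close> to the second moment about \<open>k\<close>,
  which is at least \<open>(n + 1) / 12\<close>. So \<open>M\<^sup>2 \<le> 48 / (n + 1)\<close>, and \<open>7\<^sup>2 = 49\<close>.
\<close>

lemma eulerian_prob_le: "eulerian_prob n k \<le> 7 / sqrt (n + 1)"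
proof (cases "n < 2 \<or> eulerian_prob n k = 0")
  case True
  have "sqrt (real n + 1) \<le> sqrt 49" if "n < 2"
    using that by (intro real_sqrt_le_mono) auto
  then have "1 \<le> 7 / sqrt (real n + 1)" if "n < 2"
    using that by (simp add: field_simps)
  moreover have "eulerian_prob n k \<le> 1"
    using eulerian_prob_sum_le_1[of "{k}" n] by simp
  ultimately show ?thesis
    using True by (auto simp: add.commute intro: order_trans)
next
  case False
  then obtain m where m: "n = Suc (Suc m)"
    by (metis Suc_1 add_2_eq_Suc le_Suc_ex not_less)
  have k: "0 \<le> k" "k \<le> int m + 1"
    using False eulerian_prob_Suc_eq_0[of k "Suc m"] m by force+
  define M where "M = eulerian_prob n k"
  have "M > 0"
    using False eulerian_prob_nonneg[of n k] by (simp add: M_def)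
  have zero: "eulerian_prob n (j + s) = 0"
    if "eulerian_prob n j = 0" "s = 1 \<and> j \<ge> k \<or> s = -1 \<and> j \<le> k" for j s
  proof -
    have "j < 0 \<or> j > int m + 1"
      using that(1) eulerian_prob_Suc_pos[of j "Suc m"] m by force
    then have "j + s < 0 \<or> j + s > int m + 1"
      using that(2) k by auto
    then show ?thesis
      using eulerian_prob_Suc_eq_0[of "j + s" "Suc m"] m by auto
  qed
  \<comment> \<open>The sign \<open>s\<close> selects the part of the distribution to the right or to the left of \<open>k\<close>.\<close>
  have side: "M\<^sup>2 * (\<Sum>i\<le>n. (real i)\<^sup>2 * eulerian_prob n (k + s * int i)) \<le> 2"
    if s: "s = 1 \<or> s = -1" for s
  proof -
    define c where "c i = eulerian_prob n (k + s * int i)" for i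
    have nonneg: "c i \<ge> 0" for i
      by (simp add: c_def eulerian_prob_nonneg)
    have lc: "c i * c (i + 2) \<le> (c (i + 1))\<^sup>2" for i
      using s eulerian_prob_log_concave[of n "k + s * int (i + 1)"]
      by (auto simp: c_def algebra_simps)
    have "c i = 0 \<Longrightarrow> c (Suc i) = 0" for i
      using s zero[of "k + s * int i" s] by (auto simp: c_def algebra_simps)
    from log_concave_imp_submult[of c, OF nonneg lc this]
    have submult: "c 0 * c (i + j) \<le> c i * c j" for i j .
    have "inj_on (\<lambda>i. k + s * int i) {..n}"
      using s by (auto simp: inj_on_def)
    then have "(\<Sum>i\<le>n. c i) = (\<Sum>j\<in>(\<lambda>i. k + s * int i) ` {..n}. eulerian_prob n j)"
      by (simp add: c_def sum.reindex)
    then have "(\<Sum>i\<le>n. c i) \<le> 1"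
      using eulerian_prob_sum_le_1 by simp
    from submult_seq_second_moment[of c, OF nonneg submult this]
    show ?thesis by (simp add: c_def M_def)
  qed
  define g where "g j = (j - k)\<^sup>2 * eulerian_prob n j" for j
  have g: "g j \<ge> 0" for j
    by (simp add: g_def eulerian_prob_nonneg)
  have cover: "{0..int n} \<subseteq> (\<lambda>i. k + 1 * int i) ` {..n} \<union> (\<lambda>i. k + (- 1) * int i) ` {..n}"
  proof
    fix j assume j: "j \<in> {0..int n}"
    show "j \<in> (\<lambda>i. k + 1 * int i) ` {..n} \<union> (\<lambda>i. k + (- 1) * int i) ` {..n}"
    proof (cases "k \<le> j")
      case True
      then have "j = k + 1 * int (nat (j - k))" "nat (j - k) \<le> n"
        using j k by auto
      then show ?thesis by blast
    next
      case False
      then have "j = k + (- 1) * int (nat (k - j))" "nat (k - j) \<le> n"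
        using j k m by auto
      then show ?thesis by blast
    qed
  qed
  have inj: "inj_on (\<lambda>i. k + s * int i) {..n}" if "s = 1 \<or> s = -1" for s
    using that by (auto simp: inj_on_def)
  have "(\<Sum>j\<in>{0..int n}. g j)
      \<le> (\<Sum>j\<in>(\<lambda>i. k + 1 * int i) ` {..n} \<union> (\<lambda>i. k + (- 1) * int i) ` {..n}. g j)"
    using cover g by (intro sum_mono2) auto
  also have "\<dots> \<le> (\<Sum>j\<in>(\<lambda>i. k + 1 * int i) ` {..n}. g j) + (\<Sum>j\<in>(\<lambda>i. k + (- 1) * int i) ` {..n}. g j)"
    using sum.union_inter[of "(\<lambda>i. k + 1 * int i) ` {..n}" "(\<lambda>i. k + (- 1) * int i) ` {..n}" g]
      sum_nonneg[of "(\<lambda>i. k + 1 * int i) ` {..n} \<inter> (\<lambda>i. k + (- 1) * int i) ` {..n}" g] g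
    by auto
  also have "\<dots> = (\<Sum>i\<le>n. (real i)\<^sup>2 * eulerian_prob n (k + 1 * int i))
      + (\<Sum>i\<le>n. (real i)\<^sup>2 * eulerian_prob n (k + (- 1) * int i))"
    by (subst (1 2) sum.reindex) (auto simp: inj_on_def g_def)
  finally have "M\<^sup>2 * (\<Sum>j\<in>{0..int n}. g j)
     \<le> M\<^sup>2 * ((\<Sum>i\<le>n. (real i)\<^sup>2 * eulerian_prob n (k + 1 * int i))
      + (\<Sum>i\<le>n. (real i)\<^sup>2 * eulerian_prob n (k + (- 1) * int i)))"
    by (intro mult_left_mono) auto
  also have "\<dots> \<le> 2 + 2"
    unfolding distrib_left by (intro add_mono side) auto
  finally have upper: "M\<^sup>2 * (\<Sum>j\<in>{0..int n}. g j) \<le> 4" by simp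
  have "(\<Sum>j\<in>{0..int n}. g j) \<ge> (real n + 1) / 12"
    using eulerian_prob_second_moment_ge[of m k]
    unfolding g_def m by (simp add: add.commute)
  then have "M\<^sup>2 * ((real n + 1) / 12) \<le> M\<^sup>2 * (\<Sum>j\<in>{0..int n}. g j)"
    by (intro mult_left_mono) auto
  with upper have "M\<^sup>2 * (real n + 1) \<le> 7\<^sup>2" by simp
  then have "sqrt (M\<^sup>2 * (real n + 1)) \<le> sqrt (7\<^sup>2)"
    by (rule real_sqrt_le_mono)
  then have "M * sqrt (real n + 1) \<le> 7"
    using \<open>M > 0\<close> by (simp add: real_sqrt_mult)
  then show ?thesis
    by (simp add: M_def field_simps add_pos_nonneg)
qed

section \<open>Trajectories of the MERW\<close>

lemma prob_bind_pmf:
  "measure_pmf.prob (bind_pmf q f) A = (\<integral>x. measure_pmf.prob (f x) A \<partial>measure_pmf q)"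
proof -
  have mem: "measure_pmf.prob r A = pmf (map_pmf (\<lambda>x. x \<in> A) r) True" for r
    by (auto simp: pmf_map intro!: arg_cong[of _ _ "measure_pmf.prob r"])
  show ?thesis
    unfolding mem map_bind_pmf pmf_bind ..
qed

lemma finite_unit_steps: "finite (unit_steps :: (real ^ 'd::finite) set)"
  by (simp add: unit_steps_def axis_steps_def)

lemma axis_neq_minus: "axis i (1::real) \<noteq> - axis i 1"
proof
  assume "axis i (1::real) = - axis i 1"
  from arg_cong[OF this, of "\<lambda>v. v $ i"] show False by simp
qed

lemma axis_steps_subset: "axis_steps i \<subseteq> unit_steps"
  by (auto simp: unit_steps_def)

lemma unit_steps_diff_nonempty: "unit_steps - {v :: real ^ 'd::finite} \<noteq> {}"
proof
  assume "unit_steps - {v} = {}"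
  then have "axis undefined 1 = v" "- axis undefined 1 = v"
    using axis_steps_subset[of undefined] by (auto simp: axis_steps_def)
  then show False using axis_neq_minus[of undefined] by metis
qed

lemma set_pmf_of_unit_steps_diff:
  "set_pmf (pmf_of_set (unit_steps - {v :: real ^ 'd::finite})) = unit_steps - {v}"
  by (rule set_pmf_of_set) (simp_all only: unit_steps_diff_nonempty finite_Diff finite_unit_steps not_False_eq_True)

lemma set_merw_next:
  assumes "\<And>j. j \<in> {1..n} \<Longrightarrow> step x j \<in> unit_steps" "n \<ge> 1"
  shows "set_pmf (merw_next p x n) \<subseteq> unit_steps"
  using assms unfolding merw_next_def
  by (auto simp: set_pmf_of_unit_steps_diff split: if_splits)

text \<open>
  Paths stay constant after the current time, as in the definition of the law of the walk; then
  \<open>extend x n v\<close> is the path that follows \<open>x\<close> up to time \<open>n\<close> and then makes the step \<open>v\<close>.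
\<close>

definition extend :: "(nat \<Rightarrow> 'a::plus) \<Rightarrow> nat \<Rightarrow> 'a \<Rightarrow> nat \<Rightarrow> 'a" where
  "extend x n v = (\<lambda>j. if j \<le> n then x j else x n + v)"

lemma merw_walk_Suc:
  "merw_walk init p (Suc n) =
     bind_pmf (merw_walk init p n)
       (\<lambda>x. map_pmf (extend x n) (if n = 0 then init else merw_next p x n))"
  by (simp add: map_pmf_def extend_def)

declare merw_walk.simps(2) [simp del]

lemma prob_merw_walk_Suc:
  "measure_pmf.prob (merw_walk init p (Suc n)) A =
     (\<integral>x. measure_pmf.prob (if n = 0 then init else merw_next p x n) {v. extend x n v \<in> A}
        \<partial>measure_pmf (merw_walk init p n))"
  unfolding merw_walk_Suc prob_bind_pmf by (simp add: vimage_def)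

lemma extend_le [simp]: "j \<le> n \<Longrightarrow> extend x n v j = x j"
  and extend_Suc [simp]: "extend x n v (Suc n) = x n + v"
  by (simp_all add: extend_def)

lemma step_extend [simp]: "j \<le> n \<Longrightarrow> step (extend x n v) j = step x j"
  and step_extend_Suc [simp]: "step (extend x n v) (Suc n) = v"
  by (simp_all add: step_def)

lemma set_merw_walk:
  assumes "set_pmf init \<subseteq> unit_steps" "x \<in> set_pmf (merw_walk init p n)"
  shows "x 0 = 0" "\<And>j. j \<in> {1..n} \<Longrightarrow> step x j \<in> unit_steps"
proof -
  have "x 0 = 0 \<and> (\<forall>j\<in>{1..n}. step x j \<in> unit_steps)"
    using assms(2)
  proof (induction n arbitrary: x)
    case (Suc n)
    then obtain y v where y: "y \<in> set_pmf (merw_walk init p n)" "x = extend y n v"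
      and v: "v \<in> set_pmf (if n = 0 then init else merw_next p y n)"
      by (auto simp: merw_walk_Suc)
    note IH = Suc.IH[OF y(1)]
    have "v \<in> unit_steps"
      using v assms(1) set_merw_next[of n y p] IH by (auto split: if_splits)
    then show ?case
      using IH by (auto simp: y(2) le_Suc_eq)
  qed auto
  then show "x 0 = 0" "\<And>j. j \<in> {1..n} \<Longrightarrow> step x j \<in> unit_steps" by auto
qed

lemma finite_set_merw_walk:
  fixes init :: "(real ^ 'd::finite) pmf"
  assumes "set_pmf init \<subseteq> unit_steps"
  shows "finite (set_pmf (merw_walk init p n))"
proof (induction n)
  case (Suc n)
  have "finite (set_pmf (if n = 0 then init else merw_next p x n))"
    if "x \<in> set_pmf (merw_walk init p n)" for x
  proof (rule finite_subset[OF _ finite_unit_steps])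
    show "set_pmf (if n = 0 then init else merw_next p x n) \<subseteq> unit_steps"
      using assms set_merw_next[of n x p] set_merw_walk[OF assms that] by (cases "n = 0") auto
  qed
  then show ?case
    using Suc.IH by (simp add: merw_walk_Suc)
qed auto

lemma prob_merw_walk_marginal:
  assumes "m \<le> n"
  shows "measure_pmf.prob (merw_walk init p n) {x. P (x m)} = measure_pmf.prob (merw_walk init p m) {x. P (x m)}"
  using assms
proof (induction rule: dec_induct)
  case (step n)
  have "measure_pmf.prob (merw_walk init p (Suc n)) {x. P (x m)}
      = (\<integral>x. indicator {x. P (x m)} x \<partial>measure_pmf (merw_walk init p n))"
    unfolding prob_merw_walk_Suc using step.hyps
    by (intro Bochner_Integration.integral_cong) (auto simp: indicator_def)
  then show ?case using step.IH by simp
qed simp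

section \<open>The one-dimensional ERW with parameter 0\<close>

lemma unit_steps_1: "unit_steps = {axis (1::1) (1::real), - axis 1 1}"
  by (auto simp: unit_steps_def axis_steps_def UNIV_1)

lemma erw_position:
  fixes x :: "nat \<Rightarrow> real ^ 1"
  assumes "x 0 = 0" and unit: "\<And>j. j \<in> {1..n} \<Longrightarrow> step x j \<in> unit_steps"
  shows "x n $ 1 = 2 * real (card {j \<in> {1..n}. step x j $ 1 = 1}) - real n"
    and "x n $ 1 = real n - 2 * real (card {j \<in> {1..n}. step x j $ 1 = -1})"
proof -
  have sign: "step x j $ 1 = 1 \<or> step x j $ 1 = -1" if "j \<in> {1..n}" for j
    using unit[OF that] by (auto simp: unit_steps_1)
  have "(\<Sum>j\<in>{1..n}. step x j $ 1) = x n $ 1"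
    using sum_telescope''[of 0 n "\<lambda>j. x j $ 1"] assms(1) by (simp add: step_def)
  moreover have "(\<Sum>j\<in>{1..n}. step x j $ 1)
      = (\<Sum>j\<in>{1..n}. 2 * of_bool (step x j $ 1 = 1) - 1)"
    "(\<Sum>j\<in>{1..n}. step x j $ 1) = (\<Sum>j\<in>{1..n}. 1 - 2 * of_bool (step x j $ 1 = -1))"
    using sign by (intro sum.cong refl; force)+
  moreover have "(\<Sum>j\<in>{1..n}. of_bool (P j)) = real (card {j \<in> {1..n}. P j})" for P
    by (subst sum_of_bool_eq) (auto intro!: arg_cong[of _ _ card])
  ultimately show "x n $ 1 = 2 * real (card {j \<in> {1..n}. step x j $ 1 = 1}) - real n"
    "x n $ 1 = real n - 2 * real (card {j \<in> {1..n}. step x j $ 1 = -1})"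
    by (simp_all add: sum_subtractf sum_distrib_left[symmetric])
qed

text \<open>
  With parameter \<open>0\<close> the chosen step is never repeated, and in dimension one its negative is the only
  alternative.
\<close>

lemma erw_next_eq:
  fixes x :: "nat \<Rightarrow> real ^ 1"
  assumes "n \<ge> 1" and unit: "\<And>j. j \<in> {1..n} \<Longrightarrow> step x j \<in> unit_steps"
  shows "merw_next 0 x n = map_pmf (\<lambda>j. - step x j) (pmf_of_set {1..n})"
proof -
  have "unit_steps - {step x j} = {- step x j}" if "j \<in> {1..n}" for j
    using unit[OF that] axis_neq_minus[of "1::1"] by (auto simp: unit_steps_1)
  moreover have "bernoulli_pmf 0 = return_pmf False"
    by (rule pmf_eqI) (auto simp: pmf_bernoulli_True pmf_bernoulli_False indicator_def split: bool.splits)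
  ultimately show ?thesis
    using \<open>n \<ge> 1\<close> unfolding merw_next_def map_pmf_def
    by (auto simp: bind_return_pmf pmf_of_set_singleton intro!: bind_pmf_cong)
qed

lemma erw_next_prob:
  fixes x :: "nat \<Rightarrow> real ^ 1"
  assumes "n \<ge> 1" "x 0 = 0" and unit: "\<And>j. j \<in> {1..n} \<Longrightarrow> step x j \<in> unit_steps"
  shows "measure_pmf.prob (merw_next 0 x n) {v. v $ 1 = 1} = (1 - x n $ 1 / real n) / 2"
    and "measure_pmf.prob (merw_next 0 x n) {v. v $ 1 = -1} = (1 + x n $ 1 / real n) / 2"
proof -
  have prob: "measure_pmf.prob (merw_next 0 x n) {v. v $ 1 = c}
      = real (card {j \<in> {1..n}. step x j $ 1 = - c}) / real n" for c
  proof -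
    have "{1..n} \<inter> (\<lambda>j. - step x j) -` {v. v $ 1 = c} = {j \<in> {1..n}. step x j $ 1 = - c}"
      by auto
    then show ?thesis
      using \<open>n \<ge> 1\<close> 
      by (subst erw_next_eq, simp, use unit in blast) (simp add: measure_pmf_of_set)
  qed
  show "measure_pmf.prob (merw_next 0 x n) {v. v $ 1 = 1} = (1 - x n $ 1 / real n) / 2"
    unfolding prob using \<open>n \<ge> 1\<close> by (subst erw_position(2)[OF assms(2,3)]) (auto simp: field_simps)
  show "measure_pmf.prob (merw_next 0 x n) {v. v $ 1 = -1} = (1 + x n $ 1 / real n) / 2"
    unfolding prob using \<open>n \<ge> 1\<close> by (subst erw_position(1)[OF assms(2,3)]) (auto simp: field_simps)
qed

text \<open>
  The next step depends on the past only through the position: \<open>\<plusminus>1\<close> has probability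
  \<open>(1 \<minusplus> X\<^sub>n / n) / 2\<close>, the proportion of earlier steps of the opposite sign.
\<close>

lemma erw_prob_Suc:
  fixes init :: "(real ^ 1) pmf"
  assumes "set_pmf init \<subseteq> unit_steps" "n \<ge> 1"
  shows "measure_pmf.prob (merw_walk init 0 (Suc n)) {x. x (Suc n) $ 1 = c}
    = (1 - (c - 1) / real n) / 2 * measure_pmf.prob (merw_walk init 0 n) {x. x n $ 1 = c - 1}
      + (1 + (c + 1) / real n) / 2 * measure_pmf.prob (merw_walk init 0 n) {x. x n $ 1 = c + 1}"
proof -
  let ?W = "merw_walk init 0 n"
  have "measure_pmf.prob (merw_walk init 0 (Suc n)) {x. x (Suc n) $ 1 = c}
      = (\<integral>x. measure_pmf.prob (merw_next 0 x n) {v. x n $ 1 + v $ 1 = c} \<partial>measure_pmf ?W)"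
    using \<open>n \<ge> 1\<close> unfolding prob_merw_walk_Suc by simp
  also have "\<dots> = (\<integral>x. (1 - (c - 1) / real n) / 2 * indicator {x. x n $ 1 = c - 1} x
        + (1 + (c + 1) / real n) / 2 * indicator {x. x n $ 1 = c + 1} x \<partial>measure_pmf ?W)"
  proof (intro integral_cong_AE AE_pmfI)
    fix x assume "x \<in> set_pmf ?W"
    note x = set_merw_walk[OF assms(1) this]
    have unit: "v $ 1 = 1 \<or> v $ 1 = -1" if "v \<in> set_pmf (merw_next 0 x n)" for v
      using set_merw_next[of n x 0] x(2) \<open>n \<ge> 1\<close> that by (auto simp: unit_steps_1)
    have eq: "measure_pmf.prob (merw_next 0 x n) {v. x n $ 1 + v $ 1 = c}
        = measure_pmf.prob (merw_next 0 x n) {v. v $ 1 = c - x n $ 1}"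
      by (intro arg_cong[of _ _ "measure_pmf.prob _"]) auto
    show "measure_pmf.prob (merw_next 0 x n) {v. x n $ 1 + v $ 1 = c}
      = (1 - (c - 1) / real n) / 2 * indicator {x. x n $ 1 = c - 1} x
        + (1 + (c + 1) / real n) / 2 * indicator {x. x n $ 1 = c + 1} x"
    proof (cases "x n $ 1 = c - 1 \<or> x n $ 1 = c + 1")
      case True
      then show ?thesis
        using erw_next_prob[OF assms(2) x] unfolding eq by auto
    next
      case False
      have "measure_pmf.prob (merw_next 0 x n) {v. v $ 1 = c - x n $ 1} = 0"
        using False by (auto dest!: unit simp: measure_pmf_zero_iff algebra_simps)
      then show ?thesis using False unfolding eq by auto
    qed
  qed auto
  also have "\<dots> = (1 - (c - 1) / real n) / 2 * measure_pmf.prob ?W {x. x n $ 1 = c - 1}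
      + (1 + (c + 1) / real n) / 2 * measure_pmf.prob ?W {x. x n $ 1 = c + 1}"
    by (subst Bochner_Integration.integral_add)
      (auto intro!: integrable_mult_right integrable_real_indicator simp: measure_pmf.emeasure_eq_measure)
  finally show ?thesis .
qed

text \<open>
  At time \<open>m + 2\<close>, position \<open>2 k - m\<close> means \<open>k + 1\<close> up-steps, so the descents are counted by the up-steps
  minus one. The induction starts at time \<open>2\<close>, where the walk is back at \<open>0\<close>: from there on its law
  is the same for every law of the first step.
\<close>

lemma erw_prob_eq_eulerian:
  fixes init :: "(real ^ 1) pmf"
  assumes "set_pmf init \<subseteq> unit_steps"
  shows "measure_pmf.prob (merw_walk init 0 (Suc (Suc m))) {x. x (Suc (Suc m)) $ 1 = 2 * real_of_int k - real m}
    = eulerian_prob (Suc m) k"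
proof (induction m arbitrary: k)
  case 0
  let ?P = "\<lambda>c. measure_pmf.prob (merw_walk init 0 (Suc 0)) {x. x (Suc 0) $ 1 = c}"
  have first: "x (Suc 0) $ 1 = 1 \<or> x (Suc 0) $ 1 = -1" if "x \<in> set_pmf (merw_walk init 0 (Suc 0))" for x
  proof -
    have "x 0 = 0" "step x 1 \<in> unit_steps"
      using set_merw_walk[OF assms that] by auto
    then show ?thesis by (auto simp: unit_steps_1 step_def)
  qed
  have zero: "?P c = 0" if "c \<noteq> 1" "c \<noteq> -1" for c
    using first that by (auto simp: measure_pmf_zero_iff)
  have "1 = measure_pmf.prob (merw_walk init 0 (Suc 0)) ({x. x (Suc 0) $ 1 = 1} \<union> {x. x (Suc 0) $ 1 = -1})"
    using first by (auto simp: measure_pmf.prob_eq_1 AE_measure_pmf_iff)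
  also have "\<dots> = ?P 1 + ?P (-1)"
    by (subst measure_pmf.finite_measure_Union) auto
  finally have one: "?P 1 + ?P (-1) = 1" by simp
  have rec: "measure_pmf.prob (merw_walk init 0 (Suc (Suc 0))) {x. x (Suc (Suc 0)) $ 1 = 2 * real_of_int k - real 0}
    = (1 - real_of_int k) * ?P (2 * real_of_int k - 1) + (1 + real_of_int k) * ?P (2 * real_of_int k + 1)"
    using erw_prob_Suc[OF assms, of "Suc 0" "2 * real_of_int k"] by (simp add: field_simps)
  consider "k = 0" | "k = 1" | "k = -1" | "k \<noteq> 0" "k \<noteq> 1" "k \<noteq> -1" by blast
  then show ?case
  proof cases
    case 4
    then have "2 * real_of_int k - 1 \<noteq> 1" "2 * real_of_int k - 1 \<noteq> -1"
      "2 * real_of_int k + 1 \<noteq> 1" "2 * real_of_int k + 1 \<noteq> -1"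
      by auto
    then show ?thesis unfolding rec using 4 by (simp add: zero eulerian_prob_Suc)
  qed (unfold rec, use one in \<open>auto simp: zero eulerian_prob_Suc\<close>)
next
  case (Suc m)
  have "measure_pmf.prob (merw_walk init 0 (Suc (Suc m))) {x. x (Suc (Suc m)) $ 1 = 2 * real_of_int k - real m - 2}
      = eulerian_prob (Suc m) (k - 1)"
    using Suc.IH[of "k - 1"] by (simp add: algebra_simps)
  moreover have "2 * real_of_int k - real (Suc m) - 1 = 2 * real_of_int k - real m - 2"
    "2 * real_of_int k - real (Suc m) + 1 = 2 * real_of_int k - real m" by simp_all
  moreover have "(1 - (2 * real_of_int k - real m - 2) / real (Suc (Suc m))) / 2
      = (real m + 2 - real_of_int k) / (real m + 2)"
    "(1 + (2 * real_of_int k - real m) / real (Suc (Suc m))) / 2 = (real_of_int k + 1) / (real m + 2)"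
    by (simp_all add: field_simps)
  ultimately have "measure_pmf.prob (merw_walk init 0 (Suc (Suc (Suc m))))
        {x. x (Suc (Suc (Suc m))) $ 1 = 2 * real_of_int k - real (Suc m)}
      = (real m + 2 - real_of_int k) / (real m + 2) * eulerian_prob (Suc m) (k - 1)
        + (real_of_int k + 1) / (real m + 2) * eulerian_prob (Suc m) k"
    using erw_prob_Suc[OF assms, of "Suc (Suc m)" "2 * real_of_int k - real (Suc m)"] Suc.IH[of k]
    by (simp only: One_nat_def Suc_le_mono le0 simp_thms)
  also have "\<dots> = ((real_of_int k + 1) * eulerian_prob (Suc m) k
      + (real m + 2 - real_of_int k) * eulerian_prob (Suc m) (k - 1)) / (real m + 2)"
    by (simp only: times_divide_eq_left add_divide_distrib[symmetric] add.commute)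
  also have "\<dots> = eulerian_prob (Suc (Suc m)) k"
    unfolding eulerian_prob_Suc[of "Suc m"] by (simp add: add_ac)
  finally show ?case .
qed

text \<open>
  At time \<open>m\<close> the walk lives on the integers of the parity of \<open>m\<close>, of which at most \<open>r + 1\<close> lie in
  \<open>[-r, r]\<close>.
\<close>

lemma erw_small_ball:
  fixes init :: "(real ^ 1) pmf"
  assumes init: "set_pmf init \<subseteq> unit_steps" and "1 \<le> m" "m \<le> n" "0 \<le> r"
  shows "measure_pmf.prob (merw_walk init 0 n) {x. \<bar>x m $ 1\<bar> \<le> r} \<le> 7 * (r + 1) / sqrt m"
proof (cases "m = 1")
  case True
  have "measure_pmf.prob (merw_walk init 0 n) {x. \<bar>x m $ 1\<bar> \<le> r} \<le> 1"
    by simp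
  also have "1 \<le> 7 * (r + 1) / sqrt m"
    using True \<open>0 \<le> r\<close> by simp
  finally show ?thesis .
next
  case False
  then obtain l where l: "m = Suc (Suc l)"
    using \<open>1 \<le> m\<close> by (metis One_nat_def Suc_le_D old.nat.exhaust)
  let ?W = "merw_walk init 0 m"
  define K where "K = {\<lceil>(real l - r) / 2\<rceil>..\<lfloor>(real l + r) / 2\<rfloor>}"
  have "real (card K) \<le> r + 1"
  proof -
    let ?c = "\<lfloor>(real l + r) / 2\<rfloor> - \<lceil>(real l - r) / 2\<rceil> + 1"
    have "real_of_int ?c = real_of_int \<lfloor>(real l + r) / 2\<rfloor> - real_of_int \<lceil>(real l - r) / 2\<rceil> + 1"
      by simp
    also have "\<dots> \<le> (real l + r) / 2 - (real l - r) / 2 + 1"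
      by (intro add_mono diff_mono of_int_floor_le le_of_int_ceiling order_refl)
    also have "\<dots> = r + 1" by (simp add: field_simps)
    finally have "real_of_int ?c \<le> r + 1" .
    then have "real (nat ?c) \<le> r + 1"
      using \<open>0 \<le> r\<close> by (cases "0 \<le> ?c") auto
    then show ?thesis by (simp add: K_def)
  qed
  have "measure_pmf.prob (merw_walk init 0 n) {x. \<bar>x m $ 1\<bar> \<le> r} = measure_pmf.prob ?W {x. \<bar>x m $ 1\<bar> \<le> r}"
    by (rule prob_merw_walk_marginal[OF \<open>m \<le> n\<close>])
  also have "\<dots> \<le> measure_pmf.prob ?W (\<Union>k\<in>K. {x. x m $ 1 = 2 * real_of_int k - real l})"
  proof (intro measure_pmf.finite_measure_mono_AE AE_pmfI impI)
    fix x assume "x \<in> set_pmf ?W" and x: "x \<in> {x. \<bar>x m $ 1\<bar> \<le> r}"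
    note pos = erw_position(1)[OF set_merw_walk[OF init this(1)]]
    define k where "k = int (card {j \<in> {1..m}. step x j $ 1 = 1}) - 1"
    have k: "x m $ 1 = 2 * real_of_int k - real l"
      using pos by (simp add: k_def l)
    have "k \<in> K"
      using x k unfolding K_def by (auto simp: ceiling_le_iff le_floor_iff)
    with k show "x \<in> (\<Union>k\<in>K. {x. x m $ 1 = 2 * real_of_int k - real l})" by blast
  qed auto
  also have "\<dots> \<le> (\<Sum>k\<in>K. measure_pmf.prob ?W {x. x m $ 1 = 2 * real_of_int k - real l})"
    by (intro measure_pmf.finite_measure_subadditive_finite) (auto simp: K_def)
  also have "\<dots> \<le> (\<Sum>k\<in>K. 7 / sqrt m)"
    unfolding l erw_prob_eq_eulerian[OF init]
    using eulerian_prob_le[of "Suc l"] by (intro sum_mono) (simp add: add.commute)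
  also have "\<dots> \<le> (r + 1) * (7 / sqrt m)"
    using \<open>real (card K) \<le> r + 1\<close> by (simp add: mult_right_mono divide_right_mono)
  finally show ?thesis by (simp add: mult.commute)
qed

section \<open>Transfer of discrete laws\<close>

text \<open>
  Under a law of finite support, lower bounds on the single points suffice: they bound the
  complement of \<open>A\<close> from below, hence \<open>A\<close> from above. The event \<open>D\<close> is there to apply this to
  conditional laws.
\<close>

lemma (in prob_space) prob_le_of_pmf_le:
  fixes q :: "'b pmf"
  assumes fin: "finite (set_pmf q)" and D: "D \<in> events"
    and V: "\<And>y. y \<in> set_pmf q \<Longrightarrow> {\<omega> \<in> space M. V \<omega> = y} \<in> events"
    and A: "{\<omega> \<in> space M. V \<omega> \<in> A} \<in> events"
    and le: "\<And>y. y \<in> set_pmf q \<Longrightarrow> prob D * pmf q y \<le> prob (D \<inter> {\<omega> \<in> space M. V \<omega> = y})"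
  shows "prob (D \<inter> {\<omega> \<in> space M. V \<omega> \<in> A}) \<le> prob D * measure_pmf.prob q A"
proof -
  define F where "F = set_pmf q - A"
  have F: "finite F" "\<And>y. y \<in> F \<Longrightarrow> y \<in> set_pmf q"
    using fin by (auto simp: F_def)
  have "1 - measure_pmf.prob q A = measure_pmf.prob q (- A)"
    using measure_pmf.prob_compl[of A q] by (simp add: Compl_eq_Diff_UNIV)
  also have "\<dots> = measure_pmf.prob q F"
    unfolding F_def Diff_eq by (subst Int_commute) (simp add: measure_Int_set_pmf)
  also have "\<dots> = (\<Sum>y\<in>F. pmf q y)"
    by (rule measure_measure_pmf_finite[OF F(1)])
  finally have "prob D * (1 - measure_pmf.prob q A) = (\<Sum>y\<in>F. prob D * pmf q y)"
    by (simp add: sum_distrib_left)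
  also have "\<dots> \<le> (\<Sum>y\<in>F. prob (D \<inter> {\<omega> \<in> space M. V \<omega> = y}))"
    by (intro sum_mono le F)
  also have "\<dots> = prob (\<Union>y\<in>F. D \<inter> {\<omega> \<in> space M. V \<omega> = y})"
    using F V D by (intro finite_measure_finite_Union[symmetric]) (auto simp: disjoint_family_on_def)
  finally have "prob (D \<inter> {\<omega> \<in> space M. V \<omega> \<in> A}) + prob D * (1 - measure_pmf.prob q A)
      \<le> prob (D \<inter> {\<omega> \<in> space M. V \<omega> \<in> A}) + prob (\<Union>y\<in>F. D \<inter> {\<omega> \<in> space M. V \<omega> = y})"
    by simp
  also have "\<dots> = prob ((D \<inter> {\<omega> \<in> space M. V \<omega> \<in> A}) \<union> (\<Union>y\<in>F. D \<inter> {\<omega> \<in> space M. V \<omega> = y}))"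
    using F V D A by (intro finite_measure_Union[symmetric]) (auto simp: F_def)
  also have "\<dots> \<le> prob D"
    using D by (intro finite_measure_mono) auto
  finally show ?thesis by (simp add: algebra_simps)
qed

lemma (in prob_space) prob_le_of_partition:
  assumes "finite I" "E \<in> events" "\<And>a. a \<in> I \<Longrightarrow> D a \<in> events" "disjoint_family_on D I"
    and cover: "E \<subseteq> (\<Union>a\<in>I. D a)"
    and le: "\<And>a. a \<in> I \<Longrightarrow> prob (E \<inter> D a) \<le> prob (D a) * B" and "0 \<le> B"
  shows "prob E \<le> B"
proof -
  have "prob E = prob (\<Union>a\<in>I. E \<inter> D a)"
    using cover by (intro arg_cong[of _ _ prob]) auto
  also have "\<dots> \<le> (\<Sum>a\<in>I. prob (E \<inter> D a))"
    using assms by (intro finite_measure_subadditive_finite) auto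
  also have "\<dots> \<le> (\<Sum>a\<in>I. prob (D a) * B)"
    by (intro sum_mono le)
  also have "\<dots> = prob (\<Union>a\<in>I. D a) * B"
    using assms by (subst finite_measure_finite_Union) (auto simp: sum_distrib_right)
  also have "\<dots> \<le> 1 * B"
    using \<open>0 \<le> B\<close> by (intro mult_right_mono) auto
  finally show ?thesis by simp
qed

section \<open>Linear growth of the axis counts\<close>

lemma step_cong:
  assumes "\<And>j. j \<le> n \<Longrightarrow> x j = y j" "j \<in> {1..n}"
  shows "step x j = step y j"
proof -
  have "j \<le> n" "j - 1 \<le> n" using assms(2) by auto
  then show ?thesis by (simp add: step_def assms(1))
qed

lemma merw_next_cong:
  assumes "\<And>j. j \<le> n \<Longrightarrow> x j = y j" "n \<ge> 1"
  shows "merw_next p x n = merw_next p y n"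
proof -
  have "step x j = step y j" if "j \<in> {1..n}" for j
    using step_cong[OF assms(1) that] .
  then show ?thesis
    using \<open>n \<ge> 1\<close> unfolding merw_next_def by (auto intro!: bind_pmf_cong)
qed

lemma prob_merw_walk_path_Suc:
  "measure_pmf.prob (merw_walk init p (Suc n)) {x. \<forall>j\<le>Suc n. x j = y j}
    = measure_pmf.prob (merw_walk init p n) {x. \<forall>j\<le>n. x j = y j}
      * pmf (if n = 0 then init else merw_next p y n) (y (Suc n) - y n)"
proof -
  let ?\<pi> = "\<lambda>x. if n = 0 then init else merw_next p x n"
  have "measure_pmf.prob (merw_walk init p (Suc n)) {x. \<forall>j\<le>Suc n. x j = y j}
      = (\<integral>x. indicator {x. \<forall>j\<le>n. x j = y j} x * pmf (?\<pi> y) (y (Suc n) - y n) \<partial>measure_pmf (merw_walk init p n))"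
    unfolding prob_merw_walk_Suc
  proof (intro Bochner_Integration.integral_cong refl)
    fix x
    show "measure_pmf.prob (?\<pi> x) {v. extend x n v \<in> {x. \<forall>j\<le>Suc n. x j = y j}}
        = indicator {x. \<forall>j\<le>n. x j = y j} x * pmf (?\<pi> y) (y (Suc n) - y n)"
    proof (cases "\<forall>j\<le>n. x j = y j")
      case True
      then have "{v. extend x n v \<in> {x. \<forall>j\<le>Suc n. x j = y j}} = {y (Suc n) - y n}"
        by (auto simp: le_Suc_eq algebra_simps)
      moreover have "?\<pi> x = ?\<pi> y"
        using True merw_next_cong[of n x y p] by auto
      ultimately show ?thesis using True by (simp add: measure_pmf_single)
    next
      case False
      then have empty: "{v. extend x n v \<in> {x. \<forall>j\<le>Suc n. x j = y j}} = {}"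
        by (auto simp: le_Suc_eq)
      show ?thesis unfolding empty using False by simp
    qed
  qed
  then show ?thesis by simp
qed

text \<open>
  The conditional laws determine the law of the path up to time \<open>n\<close>. This turns statements about the
  given process \<open>S\<close> into statements about \<open>merw_walk\<close>, where one can integrate step by step.
\<close>

lemma (in prob_space) is_merw_prob_path:
  assumes merw: "is_merw M k p S"
  shows "prob {\<omega> \<in> space M. \<forall>j\<le>n. S j \<omega> = y j}
    = measure_pmf.prob (merw_walk (return_pmf (axis k 1)) p n) {x. \<forall>j\<le>n. x j = y j}"
proof (induction n)
  have [measurable]: "S j \<in> borel_measurable M" for j
    using merw by (simp add: is_merw_def)
  have start: "AE \<omega> in M. S 0 \<omega> = 0 \<and> S 1 \<omega> = axis k 1"
    using merw by (simp add: is_merw_def)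
  {
    case 0
    have "prob {\<omega> \<in> space M. S 0 \<omega> = y 0} = prob {\<omega> \<in> space M. 0 = y 0}"
      using start by (intro finite_measure_eq_AE) (auto elim!: eventually_mono)
    then show ?case by (simp add: indicator_def prob_space)
  next
    case (Suc n)
    let ?E = "{\<omega> \<in> space M. \<forall>j\<le>n. S j \<omega> = y j}"
    show ?case
    proof (cases "n = 0")
      case True
      have "prob {\<omega> \<in> space M. \<forall>j\<le>Suc 0. S j \<omega> = y j} = prob {\<omega> \<in> space M. 0 = y 0 \<and> axis k 1 = y 1}"
      proof (rule finite_measure_eq_AE)
        show "AE \<omega> in M. \<omega> \<in> {\<omega> \<in> space M. \<forall>j\<le>Suc 0. S j \<omega> = y j}
            \<longleftrightarrow> \<omega> \<in> {\<omega> \<in> space M. 0 = y 0 \<and> axis k 1 = y 1}"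
          using start by eventually_elim (auto simp: le_Suc_eq)
      qed auto
      then show ?thesis
        unfolding prob_merw_walk_path_Suc True by (auto simp: indicator_def prob_space)
    next
      case False
      have split: "{\<omega> \<in> space M. \<forall>j\<le>Suc n. S j \<omega> = y j}
          = {\<omega> \<in> space M. S (n + 1) \<omega> - S n \<omega> = y (Suc n) - y n \<and> (\<forall>j\<le>n. S j \<omega> = y j)}"
        by (auto simp: le_Suc_eq)
      have "prob {\<omega> \<in> space M. \<forall>j\<le>Suc n. S j \<omega> = y j} = prob ?E * pmf (merw_next p y n) (y (Suc n) - y n)"
      proof (cases "prob ?E > 0")
        case True
        have "cond_prob M (\<lambda>\<omega>. S (n + 1) \<omega> - S n \<omega> = y (Suc n) - y n) (\<lambda>\<omega>. \<forall>j\<le>n. S j \<omega> = y j)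
            = pmf (merw_next p y n) (y (Suc n) - y n)"
          using merw True False unfolding is_merw_def by simp
        then show ?thesis
          using True unfolding split cond_prob_def by (simp add: field_simps)
      next
        case zero: False
        then have "prob ?E = 0" using measure_nonneg[of M ?E] by linarith
        moreover have "prob {\<omega> \<in> space M. \<forall>j\<le>Suc n. S j \<omega> = y j} \<le> prob ?E"
          by (intro finite_measure_mono) auto
        ultimately show ?thesis using measure_nonneg[of M] by (simp add: order_antisym)
      qed
      then show ?thesis
        using False unfolding prob_merw_walk_path_Suc Suc.IH by simp
    qed
  }
qed

lemma axis_count_extend_Suc:
  "axis_count (extend x n v) (Suc n) i = axis_count x n i + of_bool (v \<in> axis_steps i)"
proof -
  have "{j \<in> {1..Suc n}. step (extend x n v) j \<in> axis_steps i}
      = {j \<in> {1..n}. step x j \<in> axis_steps i} \<union> (if v \<in> axis_steps i then {Suc n} else {})"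
    by (auto simp: le_Suc_eq)
  then show ?thesis
    by (auto simp: axis_count_def)
qed

text \<open>
  With probability \<open>1 - p\<close> the chosen step is not repeated, and the new one is uniform among at most \<open>2 d\<close>
  steps, which always include \<open>e\<^sub>i\<close> or \<open>-e\<^sub>i\<close>.
\<close>

lemma merw_next_axis_prob_ge:
  fixes i :: "'d::finite"
  assumes "0 \<le> p" "p \<le> 1"
  shows "(1 - p) / (2 * real CARD('d)) \<le> measure_pmf.prob (merw_next p x n) (axis_steps i)"
proof -
  have fresh: "1 / (2 * real CARD('d)) \<le> measure_pmf.prob (pmf_of_set (unit_steps - {s})) (axis_steps i)"
    for s :: "real ^ 'd"
  proof -
    let ?U = "unit_steps - {s} :: (real ^ 'd) set"
    have U: "?U \<noteq> {}" "finite ?U"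
      by (rule unit_steps_diff_nonempty, simp add: finite_unit_steps)
    have "?U \<inter> axis_steps i \<noteq> {}"
      using axis_steps_subset[of i] axis_neq_minus[of i] by (auto simp: axis_steps_def)
    then have "1 \<le> card (?U \<inter> axis_steps i)"
      using U(2) by (simp add: Suc_le_eq card_gt_0_iff)
    moreover have "card (unit_steps :: (real ^ 'd) set) \<le> (\<Sum>i\<in>(UNIV::'d set). card (axis_steps i))"
      unfolding unit_steps_def by (rule card_UN_le) simp
    moreover have "\<dots> \<le> (\<Sum>i\<in>(UNIV::'d set). 2)"
      unfolding axis_steps_def by (intro sum_mono) (simp add: card_insert_if)
    moreover have "card ?U \<le> card (unit_steps :: (real ^ 'd) set)"
      by (intro card_mono finite_unit_steps) auto
    moreover have "0 < card ?U" using U by (simp add: card_gt_0_iff)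
    ultimately have "1 \<le> card (?U \<inter> axis_steps i)" "card ?U \<le> 2 * CARD('d)" "0 < card ?U"
      by auto
    moreover from this(2) have "real (card ?U) \<le> real (2 * CARD('d))"
      by (simp only: of_nat_le_iff)
    ultimately have "1 \<le> real (card (?U \<inter> axis_steps i))" "real (card ?U) \<le> 2 * real CARD('d)" "0 < real (card ?U)"
      by simp_all
    then show ?thesis
      using U by (subst measure_pmf_of_set) (auto intro!: frac_le)
  qed
  have "(1 - p) / (2 * real CARD('d))
      \<le> measure_pmf.prob (bernoulli_pmf p \<bind> (\<lambda>repeat. if repeat then return_pmf s
            else pmf_of_set (unit_steps - {s}))) (axis_steps i)" for s
  proof -
    have "(1 - p) * (1 / (2 * real CARD('d)))
        \<le> (1 - p) * measure_pmf.prob (pmf_of_set (unit_steps - {s})) (axis_steps i)"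
      using assms by (intro mult_left_mono fresh) auto
    moreover have "0 \<le> p * measure_pmf.prob (return_pmf s) (axis_steps i)"
      using assms by (intro mult_nonneg_nonneg measure_nonneg)
    ultimately have "(1 - p) / (2 * real CARD('d))
        \<le> measure_pmf.prob (return_pmf s) (axis_steps i) * p
          + measure_pmf.prob (pmf_of_set (unit_steps - {s})) (axis_steps i) * (1 - p)"
      by (simp only: times_divide_eq_right mult_1_right mult.commute[of p] mult.commute[of "1 - p"])
    then show ?thesis
      unfolding prob_bind_pmf using assms
      by (subst integral_bernoulli_pmf) (simp_all del: measure_return_pmf)
  qed
  then show ?thesis
    unfolding merw_next_def by (subst prob_bind_pmf)
      (intro measure_pmf.integral_ge_const AE_pmfI measure_pmf.integrable_const_bound[where B=1], auto)
qed

lemma decay_rate_ge_half: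
  assumes "0 \<le> p" "p \<le> 1"
  shows "1 / 2 \<le> 1 - (1 - p) / (4 * real CARD('d::finite))"
proof -
  have "1 \<le> real CARD('d)" by (simp add: Suc_le_eq)
  then have "(1 - p) / (4 * real CARD('d)) \<le> 2 / 4"
    using assms by (intro frac_le) auto
  then show ?thesis by simp
qed

text \<open>
  Every step after the first multiplies \<open>2\<^sup>-\<^sup>b\<close> by \<open>1/2\<close> with conditional probability at least
  \<open>(1 - p) / (2 d)\<close>, and otherwise leaves it unchanged.
\<close>

lemma axis_count_exp_moment:
  fixes i :: "'d::finite"
  assumes p: "0 \<le> p" "p \<le> 1"
  shows "(\<integral>\<^sup>+x. ennreal ((1 / 2) ^ axis_count x (Suc n) i) \<partial>measure_pmf (merw_walk init p (Suc n)))
    \<le> ennreal ((1 - (1 - p) / (4 * real CARD('d))) ^ n)"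
proof (induction n)
  case 0
  have "(\<integral>\<^sup>+x. ennreal ((1 / 2) ^ axis_count x (Suc 0) i) \<partial>measure_pmf (merw_walk init p (Suc 0)))
      \<le> (\<integral>\<^sup>+x. 1 \<partial>measure_pmf (merw_walk init p (Suc 0)))"
    by (intro nn_integral_mono) (simp add: power_le_one)
  then show ?case by simp
next
  case (Suc n)
  let ?\<rho> = "1 - (1 - p) / (4 * real CARD('d))"
  have \<rho>: "0 \<le> ?\<rho>"
    using decay_rate_ge_half[OF p, where 'd='d] by simp
  have inner: "(\<integral>\<^sup>+v. ennreal ((1 / 2) ^ of_bool (v \<in> axis_steps i)) \<partial>measure_pmf (merw_next p x (Suc n)))
      \<le> ennreal ?\<rho>" for x
  proof -
    have "(\<integral>\<^sup>+v. ennreal ((1 / 2) ^ of_bool (v \<in> axis_steps i)) \<partial>measure_pmf (merw_next p x (Suc n)))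
      = (\<integral>\<^sup>+v. ennreal (1 - 1 / 2 * indicator (axis_steps i) v) \<partial>measure_pmf (merw_next p x (Suc n)))"
      by (intro nn_integral_cong) (simp add: indicator_def)
    also have "\<dots> = ennreal (\<integral>v. 1 - 1 / 2 * indicator (axis_steps i) v \<partial>measure_pmf (merw_next p x (Suc n)))"
      by (intro nn_integral_eq_integral measure_pmf.integrable_const_bound[where B=1])
        (auto simp: indicator_def)
    also have "(\<integral>v. 1 - 1 / 2 * indicator (axis_steps i) v \<partial>measure_pmf (merw_next p x (Suc n)))
        = 1 - 1 / 2 * measure_pmf.prob (merw_next p x (Suc n)) (axis_steps i)"
      by (subst Bochner_Integration.integral_diff)
        (auto intro!: integrable_mult_right integrable_real_indicator simp: measure_pmf.emeasure_eq_measure)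
    also have "ennreal \<dots> \<le> ennreal ?\<rho>"
      using merw_next_axis_prob_ge[OF p, of x "Suc n" i] by (intro ennreal_leI) (simp add: field_simps)
    finally show ?thesis .
  qed
  have "(\<integral>\<^sup>+x. ennreal ((1 / 2) ^ axis_count x (Suc (Suc n)) i) \<partial>measure_pmf (merw_walk init p (Suc (Suc n))))
      = (\<integral>\<^sup>+x. ennreal ((1 / 2) ^ axis_count x (Suc n) i) *
          (\<integral>\<^sup>+v. ennreal ((1 / 2) ^ of_bool (v \<in> axis_steps i)) \<partial>measure_pmf (merw_next p x (Suc n)))
          \<partial>measure_pmf (merw_walk init p (Suc n)))"
    unfolding merw_walk_Suc[of _ _ "Suc n"]
    by (simp add: axis_count_extend_Suc power_add ennreal_mult nn_integral_cmult)
  also have "\<dots> \<le> (\<integral>\<^sup>+x. ennreal ((1 / 2) ^ axis_count x (Suc n) i) * ennreal ?\<rho>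
      \<partial>measure_pmf (merw_walk init p (Suc n)))"
    by (intro nn_integral_mono mult_left_mono inner) auto
  also have "\<dots> = (\<integral>\<^sup>+x. ennreal ((1 / 2) ^ axis_count x (Suc n) i)
      \<partial>measure_pmf (merw_walk init p (Suc n))) * ennreal ?\<rho>"
    by (rule nn_integral_multc) simp
  also have "\<dots> \<le> ennreal (?\<rho> ^ n) * ennreal ?\<rho>"
    by (intro mult_right_mono Suc.IH) simp
  also have "\<dots> = ennreal (?\<rho> ^ Suc n)"
    using \<rho> by (simp add: ennreal_mult[symmetric] mult.commute)
  finally show ?case .
qed

lemma axis_count_lower_tail:
  fixes i :: "'d::finite" and \<delta> :: real
  assumes p: "0 \<le> p" "p \<le> 1"
  shows "measure_pmf.prob (merw_walk init p (Suc n)) {x. real (axis_count x (Suc n) i) < \<delta> * real (Suc n)}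
    \<le> 2 powr (\<delta> * real (Suc n)) * (1 - (1 - p) / (4 * real CARD('d))) ^ n"
proof -
  let ?W = "measure_pmf (merw_walk init p (Suc n))"
  let ?A = "{x. real (axis_count x (Suc n) i) < \<delta> * real (Suc n)}"
  let ?\<rho> = "1 - (1 - p) / (4 * real CARD('d))"
  have \<rho>: "0 \<le> ?\<rho>"
    using decay_rate_ge_half[OF p, where 'd='d] by simp
  have "ennreal (measure ?W ?A) = (\<integral>\<^sup>+x. indicator ?A x \<partial>?W)"
    by (simp add: measure_pmf.emeasure_eq_measure)
  also have "\<dots> \<le> (\<integral>\<^sup>+x. ennreal (2 powr (\<delta> * real (Suc n))) * ennreal ((1 / 2) ^ axis_count x (Suc n) i) \<partial>?W)"
  proof (intro nn_integral_mono)
    fix x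
    have "1 \<le> 2 powr (\<delta> * real (Suc n)) * (1 / 2) ^ axis_count x (Suc n) i" if "x \<in> ?A"
    proof -
      have "(2::real) ^ axis_count x (Suc n) i \<le> 2 powr (\<delta> * real (Suc n))"
        using that by (subst powr_realpow[symmetric]) auto
      then show ?thesis by (simp add: power_divide field_simps)
    qed
    then show "indicator ?A x \<le> ennreal (2 powr (\<delta> * real (Suc n))) * ennreal ((1 / 2) ^ axis_count x (Suc n) i)"
      by (auto simp: indicator_def ennreal_mult[symmetric])
  qed
  also have "\<dots> = ennreal (2 powr (\<delta> * real (Suc n))) * (\<integral>\<^sup>+x. ennreal ((1 / 2) ^ axis_count x (Suc n) i) \<partial>?W)"
    by (rule nn_integral_cmult) simp
  also have "\<dots> \<le> ennreal (2 powr (\<delta> * real (Suc n))) * ennreal (?\<rho> ^ n)"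
    by (intro mult_left_mono axis_count_exp_moment p) simp
  also have "\<dots> = ennreal (2 powr (\<delta> * real (Suc n)) * ?\<rho> ^ n)"
    using \<rho> by (simp add: ennreal_mult)
  finally show ?thesis
    using \<rho> by (subst (asm) ennreal_le_iff) auto
qed

section \<open>Small balls for independent and for coupled walks\<close>

lemma set_init_erw: "set_pmf (if b then return_pmf (axis 1 1) else pmf_of_set unit_steps) \<subseteq> (unit_steps :: (real ^ 1) set)"
  by (auto simp: unit_steps_1 set_pmf_of_set)

lemma finite_set_indep_erws: "finite (set_pmf (indep_erws k q n))"
  unfolding indep_erws_def
proof (subst set_Pi_pmf, simp, rule finite_PiE_dflt)
  fix i
  let ?init = "\<lambda>i. if i = k then return_pmf (axis 1 1) else pmf_of_set unit_steps :: (real ^ 1) pmf"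
  show "finite ((set_pmf \<circ> (\<lambda>i. merw_walk (?init i) q n)) i)"
    unfolding comp_def by (intro finite_set_merw_walk set_init_erw)
qed simp

lemma indep_erws_small_ball:
  fixes k :: "'d::finite"
  assumes a: "\<And>i. 1 \<le> a i" "\<And>i. a i \<le> n" and L: "0 < L" "\<And>i. L \<le> real (a i)" and "0 \<le> r"
  shows "measure_pmf.prob (indep_erws k 0 n) {X. norm (\<chi> i. X i (a i) $ 1) \<le> r}
    \<le> (7 * (r + 1) / sqrt L) ^ CARD('d)"
proof -
  have "measure_pmf.prob (indep_erws k 0 n) {X. norm (\<chi> i. X i (a i) $ 1) \<le> r}
      \<le> measure_pmf.prob (indep_erws k 0 n) (Pi UNIV (\<lambda>i. {x. \<bar>x (a i) $ 1\<bar> \<le> r}))"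
  proof (intro measure_pmf.finite_measure_mono subsetI Pi_I)
    fix X :: "'d \<Rightarrow> nat \<Rightarrow> real ^ 1" and i assume "X \<in> {X. norm (\<chi> i. X i (a i) $ 1) \<le> r}"
    then show "X i \<in> {x. \<bar>x (a i) $ 1\<bar> \<le> r}"
      using component_le_norm_cart[of "\<chi> i. X i (a i) $ 1" i] by simp
  qed auto
  also have "\<dots> \<le> (\<Prod>i\<in>(UNIV::'d set). 7 * (r + 1) / sqrt L)"
    unfolding indep_erws_def
  proof (subst measure_Pi_pmf_Pi, simp, intro prod_mono conjI measure_nonneg)
    fix i
    let ?init = "if i = k then return_pmf (axis 1 1) else pmf_of_set unit_steps :: (real ^ 1) pmf"
    have "measure_pmf.prob (merw_walk ?init 0 n)
        {x. \<bar>x (a i) $ 1\<bar> \<le> r} \<le> 7 * (r + 1) / sqrt (a i)"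
      by (intro erw_small_ball set_init_erw a \<open>0 \<le> r\<close>)
    also have "\<dots> \<le> 7 * (r + 1) / sqrt L"
    proof (intro divide_left_mono mult_pos_pos)
      have "0 < real (a i)" using L(1) L(2)[of i] by linarith
      then show "0 < sqrt (real (a i))" by simp
    qed (use L \<open>0 \<le> r\<close> in auto)
    finally show "measure_pmf.prob (merw_walk ?init 0 n)
        {x. \<bar>x (a i) $ 1\<bar> \<le> r} \<le> 7 * (r + 1) / sqrt L" .
  qed
  finally show ?thesis by simp
qed

lemma restrict_eq_iff: "restrict f A = restrict g A \<longleftrightarrow> (\<forall>x\<in>A. f x = g x)"
  by (metis restrict_apply' restrict_ext)

lemma axis_count_cong:
  assumes "\<And>j. j \<le> n \<Longrightarrow> x j = y j"
  shows "axis_count x n i = axis_count y n i"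
proof -
  have "step x j = step y j" if "j \<in> {1..n}" for j
    using step_cong[OF assms that] .
  then show ?thesis
    unfolding axis_count_def by (intro arg_cong[of _ _ card]) auto
qed

lemma measurable_axis_count:
  fixes S :: "nat \<Rightarrow> 'w \<Rightarrow> real ^ 'd::finite"
  assumes [measurable]: "\<And>n. S n \<in> borel_measurable M"
  shows "(\<lambda>\<omega>. real (axis_count (\<lambda>j. S j \<omega>) n i)) \<in> borel_measurable M"
proof -
  have "real (axis_count (\<lambda>j. S j \<omega>) n i)
      = (\<Sum>j\<in>{1..n}. if S j \<omega> - S (j - 1) \<omega> = axis i 1 \<or> S j \<omega> - S (j - 1) \<omega> = - axis i 1 then 1 else 0)"
    for \<omega>
  proof -
    have "{j \<in> {1..n}. step (\<lambda>j. S j \<omega>) j \<in> axis_steps i}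
        = {1..n} \<inter> {j. S j \<omega> - S (j - 1) \<omega> = axis i 1 \<or> S j \<omega> - S (j - 1) \<omega> = - axis i 1}"
      by (auto simp: step_def axis_steps_def)
    then show ?thesis
      unfolding axis_count_def by (simp add: sum.If_cases)
  qed
  then show ?thesis
    by simp
qed

lemma axis_count_le: "axis_count x n i \<le> n"
  unfolding axis_count_def by (rule order_trans[OF card_mono[of "{1..n}"]]) auto

text \<open>
  Restricting paths to \<open>{..n}\<close> makes agreement up to time \<open>n\<close> an equality of functions, so that
  \<open>prob_le_of_pmf_le\<close> applies to the path of \<open>S\<close>.
\<close>

lemma (in prob_space) merw_axis_count_tail:
  fixes S :: "nat \<Rightarrow> 'a \<Rightarrow> real ^ 'd::finite"
  assumes merw: "is_merw M k p S" and p: "0 \<le> p" "p \<le> 1"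
  shows "prob {\<omega> \<in> space M. real (axis_count (\<lambda>j. S j \<omega>) (Suc n) i) < \<delta> * real (Suc n)}
    \<le> 2 powr (\<delta> * real (Suc n)) * (1 - (1 - p) / (4 * real CARD('d))) ^ n"
proof -
  let ?N = "Suc n"
  let ?W = "merw_walk (return_pmf (axis k 1)) p ?N"
  let ?V = "\<lambda>\<omega>. restrict (\<lambda>j. S j \<omega>) {..?N}"
  let ?q = "map_pmf (\<lambda>x. restrict x {..?N}) ?W"
  let ?A = "{x. real (axis_count x ?N i) < \<delta> * real ?N}"
  have [measurable]: "S j \<in> borel_measurable M" for j
    using merw by (simp add: is_merw_def)
  have [measurable]: "(\<lambda>\<omega>. real (axis_count (\<lambda>j. S j \<omega>) m i)) \<in> borel_measurable M" for m
    by (rule measurable_axis_count) measurable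
  have restr: "restrict x {..?N} \<in> ?A \<longleftrightarrow> x \<in> ?A" for x :: "nat \<Rightarrow> real ^ 'd"
    using axis_count_cong[of ?N "restrict x {..?N}" x i] by simp
  have V_eq: "{\<omega> \<in> space M. ?V \<omega> = restrict y {..?N}} = {\<omega> \<in> space M. \<forall>j\<le>?N. S j \<omega> = y j}" for y
    by (auto simp: restrict_eq_iff)
  have init: "set_pmf (return_pmf (axis k 1)) \<subseteq> unit_steps"
    using axis_steps_subset[of k] by (auto simp: axis_steps_def)
  have "prob (space M \<inter> {\<omega> \<in> space M. ?V \<omega> \<in> ?A}) \<le> prob (space M) * measure_pmf.prob ?q ?A"
  proof (rule prob_le_of_pmf_le)
    show "finite (set_pmf ?q)"
      using finite_set_merw_walk[OF init] by simp
    show "{\<omega> \<in> space M. ?V \<omega> \<in> ?A} \<in> events"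
      unfolding restr by simp
    fix y assume "y \<in> set_pmf ?q"
    then obtain x where y: "y = restrict x {..?N}" by auto
    show "{\<omega> \<in> space M. ?V \<omega> = y} \<in> events"
      unfolding y V_eq by measurable
    have "(\<lambda>x. restrict x {..?N}) -` {y} = {z. \<forall>j\<le>?N. z j = x j}"
      by (auto simp: y restrict_eq_iff)
    then have "pmf ?q y = prob {\<omega> \<in> space M. ?V \<omega> = y}"
      unfolding y V_eq is_merw_prob_path[OF merw] by (simp add: pmf_map)
    then show "prob (space M) * pmf ?q y \<le> prob (space M \<inter> {\<omega> \<in> space M. ?V \<omega> = y})"
      by (simp add: prob_space Int_absorb1)
  qed simp
  moreover have "space M \<inter> {\<omega> \<in> space M. ?V \<omega> \<in> ?A}
      = {\<omega> \<in> space M. real (axis_count (\<lambda>j. S j \<omega>) ?N i) < \<delta> * real ?N}"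
    unfolding restr by auto
  moreover have "measure_pmf.prob ?q ?A = measure_pmf.prob ?W ?A"
  proof -
    have "(\<lambda>x. restrict x {..?N}) -` ?A = ?A"
      using restr by blast
    then show ?thesis by simp
  qed
  ultimately show ?thesis
    using axis_count_lower_tail[OF p, of "return_pmf (axis k 1)" n i \<delta>] by (simp add: prob_space)
qed

text \<open>
  Split according to the whole history \<open>a\<close> of the axis counts up to time \<open>n\<close>, which takes finitely many
  values. Given \<open>a\<close>, the coupling describes \<open>T\<^sub>n\<close> by independent ERWs observed at the times \<open>a n i\<close>, and
  only histories with \<open>a n i \<ge> L\<close> for all \<open>i\<close> contribute.
\<close>

lemma (in prob_space) coupled_small_ball:
  fixes S T :: "nat \<Rightarrow> 'a \<Rightarrow> real ^ 'd::finite"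
  assumes S [measurable]: "\<And>n. S n \<in> borel_measurable M" and T [measurable]: "\<And>n. T n \<in> borel_measurable M"
    and coupled: "coupled M k S T"
    and n: "1 \<le> n" and "0 < L" "0 \<le> r"
  shows "prob {\<omega> \<in> space M. norm (T n \<omega>) \<le> r \<and> (\<forall>i. L \<le> real (axis_count (\<lambda>j. S j \<omega>) n i))}
    \<le> (7 * (r + 1) / sqrt L) ^ CARD('d)"
proof -
  let ?C = "\<lambda>\<omega> m i. axis_count (\<lambda>j. S j \<omega>) m i"
  define B where "B = (7 * (r + 1) / sqrt L) ^ CARD('d)"
  define I where "I = PiE {1..n} (\<lambda>m. PiE (UNIV :: 'd set) (\<lambda>i. {..m}))"
  define D where "D a = {\<omega> \<in> space M. \<forall>m\<in>{1..n}. \<forall>i. ?C \<omega> m i = a m i}" for a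
  define E where "E = {\<omega> \<in> space M. norm (T n \<omega>) \<le> r \<and> (\<forall>i. L \<le> real (?C \<omega> n i))}"
  have [measurable]: "(\<lambda>\<omega>. real (?C \<omega> m i)) \<in> borel_measurable M" for m i
    by (rule measurable_axis_count) measurable
  have D_events [measurable]: "D a \<in> events" for a
  proof -
    have "{\<omega> \<in> space M. \<forall>m\<in>{1..n}. \<forall>i. real (?C \<omega> m i) = real (a m i)} \<in> events"
      by measurable
    then show ?thesis by (simp add: D_def)
  qed
  have E_events: "E \<in> events"
    unfolding E_def by measurable
  have "prob E \<le> B"
  proof (rule prob_le_of_partition)
    show "finite I"
      unfolding I_def by (intro finite_PiE) auto
    show "disjoint_family_on D I"
    proof (unfold disjoint_family_on_def, intro ballI impI)
      fix a b assume ab: "a \<in> I" "b \<in> I" "a \<noteq> b"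
      then obtain m where m: "m \<in> {1..n}" "a m \<noteq> b m"
        unfolding I_def by (meson PiE_ext)
      then obtain i where "a m i \<noteq> b m i" by blast
      with m(1) show "D a \<inter> D b = {}" by (auto simp: D_def)
    qed
    show "E \<subseteq> (\<Union>a\<in>I. D a)"
    proof
      fix \<omega> assume "\<omega> \<in> E"
      then have "\<omega> \<in> D (restrict (?C \<omega>) {1..n})"
        by (simp add: D_def E_def)
      moreover have "restrict (?C \<omega>) {1..n} \<in> I"
        by (auto simp: I_def axis_count_le)
      ultimately show "\<omega> \<in> (\<Union>a\<in>I. D a)" by blast
    qed
    show "0 \<le> B"
      using \<open>0 \<le> r\<close> \<open>0 < L\<close> by (simp add: B_def)
    fix a assume "a \<in> I"
    then have a_le: "a n i \<le> n" for i
      using n by (auto simp: I_def PiE_iff)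
    show "prob (E \<inter> D a) \<le> prob (D a) * B"
    proof (cases "\<forall>i. L \<le> real (a n i)")
      case False
      then have "E \<inter> D a = {}"
        using n by (auto simp: E_def D_def)
      then show ?thesis using \<open>0 \<le> B\<close> by simp
    next
      case True
      let ?R = "\<lambda>X :: 'd \<Rightarrow> nat \<Rightarrow> real ^ 1. restrict (\<lambda>m. \<chi> i. X i (a m i) $ 1) {1..n}"
      let ?V = "\<lambda>\<omega>. restrict (\<lambda>m. T m \<omega>) {1..n}"
      let ?q = "map_pmf ?R (indep_erws k 0 n)"
      let ?A = "{y. norm (y n) \<le> r}"
      have V_eq: "{\<omega> \<in> space M. ?V \<omega> = restrict y {1..n}} = {\<omega> \<in> space M. \<forall>m\<in>{1..n}. T m \<omega> = y m}" for y
        by (auto simp: restrict_eq_iff)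
      have A_eq: "{\<omega> \<in> space M. ?V \<omega> \<in> ?A} = {\<omega> \<in> space M. norm (T n \<omega>) \<le> r}"
        using n by simp
      have "prob (E \<inter> D a) \<le> prob (D a \<inter> {\<omega> \<in> space M. ?V \<omega> \<in> ?A})"
        unfolding A_eq by (intro finite_measure_mono) (auto simp: E_def)
      also have "\<dots> \<le> prob (D a) * measure_pmf.prob ?q ?A"
      proof (rule prob_le_of_pmf_le)
        show "finite (set_pmf ?q)"
          by (simp add: finite_set_indep_erws)
        show "{\<omega> \<in> space M. ?V \<omega> \<in> ?A} \<in> events"
          unfolding A_eq by measurable
        fix y assume "y \<in> set_pmf ?q"
        then obtain y' where y: "y = restrict y' {1..n}" by auto
        show "{\<omega> \<in> space M. ?V \<omega> = y} \<in> events"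
          unfolding y V_eq by measurable
        show "prob (D a) * pmf ?q y \<le> prob (D a \<inter> {\<omega> \<in> space M. ?V \<omega> = y})"
        proof (cases "prob (D a) = 0")
          case False
          then have pos: "prob (D a) > 0"
            using measure_nonneg[of M "D a"] by linarith
          have "?R -` {y} = {X. \<forall>m\<in>{1..n}. (\<chi> i. X i (a m i) $ 1) = y' m}"
            by (auto simp: y restrict_eq_iff)
          then have "pmf ?q y
              = measure_pmf.prob (indep_erws k 0 n) {X. \<forall>m\<in>{1..n}. (\<chi> i. X i (a m i) $ 1) = y' m}"
            by (simp add: pmf_map)
          also have "\<dots> = cond_prob M (\<lambda>\<omega>. \<forall>m\<in>{1..n}. T m \<omega> = y' m) (\<lambda>\<omega>. \<forall>m\<in>{1..n}. \<forall>i. ?C \<omega> m i = a m i)"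
            using coupled n pos unfolding coupled_def D_def by simp
          also have "\<dots> = prob (D a \<inter> {\<omega> \<in> space M. ?V \<omega> = y}) / prob (D a)"
            unfolding cond_prob_def y V_eq D_def
            by (intro arg_cong2[of _ _ _ _ "(/)"] arg_cong[of _ _ prob]) auto
          finally show ?thesis using pos by simp
        qed simp
      qed simp
      also have "measure_pmf.prob ?q ?A = measure_pmf.prob (indep_erws k 0 n) {X. norm (\<chi> i. X i (a n i) $ 1) \<le> r}"
        using n by (simp add: vimage_def)
      also have "\<dots> \<le> B"
        unfolding B_def
      proof (rule indep_erws_small_ball)
        fix i
        have "0 < real (a n i)" using True \<open>0 < L\<close> by (meson less_le_trans)
        then show "1 \<le> a n i" by simp
      qed (use True a_le \<open>0 < L\<close> \<open>0 \<le> r\<close> in auto)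
      finally show ?thesis by (simp add: mult_left_mono)
    qed
  qed (use E_events in auto)
  then show ?thesis by (simp add: E_def B_def)
qed

section \<open>Escape at polynomial speed\<close>

theorem proposition1p13:
  fixes M :: "'w measure"
    and k :: "'d::finite"
    and S T :: "nat \<Rightarrow> 'w \<Rightarrow> real ^ 'd"
    and p \<nu> :: real
  assumes "prob_space M"
    and "CARD('d) \<ge> 3"
    and "0 \<le> p" "p < 1"
    and "is_merw M k p S"
    and "is_derw M k p 0 T"
    and "coupled M k S T"
    and "0 < \<nu>" "\<nu> < 1 / 2 - 1 / real CARD('d)"
  shows "(\<integral>\<^sup>+ \<omega>. (\<Sum>n. indicator {\<omega>. norm (S (Suc n) \<omega>) \<le> real (Suc n) powr \<nu>} \<omega>) \<partial>M)
           \<le> (\<integral>\<^sup>+ \<omega>. (\<Sum>n. indicator {\<omega>. norm (T (Suc n) \<omega>) \<le> real (Suc n) powr \<nu>} \<omega>) \<partial>M)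
       \<and> (\<integral>\<^sup>+ \<omega>. (\<Sum>n. indicator {\<omega>. norm (T (Suc n) \<omega>) \<le> real (Suc n) powr \<nu>} \<omega>) \<partial>M) < \<infinity>
       \<and> (AE \<omega> in M. eventually (\<lambda>n. norm (S n \<omega>) > real n powr \<nu>) sequentially)"
proof -
  interpret prob_space M by fact
  let ?d = "CARD('d)"
  have S_meas [measurable]: "S n \<in> borel_measurable M" for n
    using assms(5) by (simp add: is_merw_def)
  have T_meas [measurable]: "T n \<in> borel_measurable M" for n
    using assms(6) by (simp add: is_derw_def)
  let ?smallS = "\<lambda>n. {\<omega>. norm (S (Suc n) \<omega>) \<le> real (Suc n) powr \<nu>}"
  let ?smallT = "\<lambda>n. {\<omega>. norm (T (Suc n) \<omega>) \<le> real (Suc n) powr \<nu>}"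
  let ?IS = "\<integral>\<^sup>+ \<omega>. (\<Sum>n. indicator (?smallS n) \<omega>) \<partial>M"
  let ?IT = "\<integral>\<^sup>+ \<omega>. (\<Sum>n. indicator (?smallT n) \<omega>) \<partial>M"
  have meas: "(\<lambda>\<omega>. indicator {\<omega>. norm (X (Suc n) \<omega>) \<le> real (Suc n) powr \<nu>} \<omega> :: ennreal) \<in> borel_measurable M"
    if [measurable]: "\<And>n. X n \<in> borel_measurable M" for X :: "nat \<Rightarrow> 'w \<Rightarrow> real ^ 'd" and n
  proof -
    have "(\<lambda>\<omega>. indicator {\<omega>. norm (X (Suc n) \<omega>) \<le> real (Suc n) powr \<nu>} \<omega> :: ennreal)
        = (\<lambda>\<omega>. if norm (X (Suc n) \<omega>) \<le> real (Suc n) powr \<nu> then 1 else 0)"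
      by (auto simp: indicator_def)
    then show ?thesis by simp
  qed

  have dominated: "AE \<omega> in M. \<forall>n. norm (T n \<omega>) \<le> norm (S n \<omega>)"
  proof -
    have "AE \<omega> in M. \<forall>n i. \<bar>T n \<omega> $ i\<bar> \<le> \<bar>S n \<omega> $ i\<bar>"
      using assms(7) by (simp add: coupled_def)
    then show ?thesis
      by eventually_elim (auto intro!: norm_le_componentwise_cart)
  qed
  have le: "?IS \<le> ?IT"
  proof (rule nn_integral_mono_AE)
    show "AE \<omega> in M. (\<Sum>n. indicator (?smallS n) \<omega> :: ennreal) \<le> (\<Sum>n. indicator (?smallT n) \<omega>)"
      using dominated
    proof eventually_elim
      case (elim \<omega>)
      have "indicator (?smallS n) \<omega> \<le> (indicator (?smallT n) \<omega> :: ennreal)" for n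
        using elim[rule_format, of "Suc n"] by (auto simp: indicator_def)
      then show ?case by (intro suminf_le) auto
    qed
  qed

  \<comment> \<open>The choice of \<open>\<delta>\<close> with \<open>2\<^sup>\<delta> = 1 / \<surd>\<rho>\<close> loses half of the exponential decay \<open>\<rho>\<^sup>n\<close> to \<open>2\<^sup>\<delta>\<^sup>n\<close>.\<close>
  define \<rho> where "\<rho> = 1 - (1 - p) / (4 * real ?d)"
  define s where "s = sqrt \<rho>"
  define \<delta> where "\<delta> = - log 2 s"
  have "1 / 2 \<le> \<rho>"
    using decay_rate_ge_half[of p, where 'd='d] assms(3,4) by (simp add: \<rho>_def)
  moreover have "\<rho> < 1"
    using assms(2,4) by (simp add: \<rho>_def)
  ultimately have s: "0 < s" "s < 1" "\<rho> = s * s"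
    by (auto simp: s_def)
  have \<delta>: "0 < \<delta>" "2 powr \<delta> = 1 / s"
    using s by (auto simp: \<delta>_def powr_minus divide_simps)

  define e where "e = (\<nu> - 1 / 2) * real ?d"
  have e: "e < -1"
  proof -
    have "\<nu> - 1 / 2 < - 1 / real ?d" using assms(9) by simp
    then have "(\<nu> - 1 / 2) * real ?d < - 1 / real ?d * real ?d"
      using assms(2) by (intro mult_strict_right_mono) auto
    then show ?thesis using assms(2) by (simp add: e_def)
  qed

  \<comment> \<open>The two summands bound the events that some axis is rarely used and that \<open>T\<close> is small otherwise.\<close>
  define b where "b n = real ?d * (1 / s * s ^ n) + (14 / sqrt \<delta>) ^ ?d * real (Suc n) powr e" for n
  have bound: "prob {\<omega> \<in> space M. norm (T (Suc n) \<omega>) \<le> real (Suc n) powr \<nu>} \<le> b n" for n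
  proof -
    let ?N = "real (Suc n)"
    let ?L = "\<delta> * ?N"
    let ?few = "\<lambda>i. {\<omega> \<in> space M. real (axis_count (\<lambda>j. S j \<omega>) (Suc n) i) < ?L}"
    let ?many = "{\<omega> \<in> space M. norm (T (Suc n) \<omega>) \<le> ?N powr \<nu> \<and>
        (\<forall>i. ?L \<le> real (axis_count (\<lambda>j. S j \<omega>) (Suc n) i))}"
    have [measurable]: "(\<lambda>\<omega>. real (axis_count (\<lambda>j. S j \<omega>) m i)) \<in> borel_measurable M" for m i
      by (rule measurable_axis_count) measurable
    have "prob {\<omega> \<in> space M. norm (T (Suc n) \<omega>) \<le> ?N powr \<nu>} \<le> prob ((\<Union>i\<in>UNIV. ?few i) \<union> ?many)"
      by (intro finite_measure_mono) (auto simp: not_le)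
    also have "\<dots> \<le> prob (\<Union>i\<in>UNIV. ?few i) + prob ?many"
      by (intro measure_Un_le) auto
    also have "prob (\<Union>i\<in>UNIV. ?few i) \<le> (\<Sum>i\<in>UNIV. prob (?few i))"
      by (intro finite_measure_subadditive_finite) auto
    also have "\<dots> \<le> (\<Sum>i\<in>(UNIV::'d set). 1 / s * s ^ n)"
    proof (intro sum_mono)
      fix i
      have "prob (?few i) \<le> 2 powr (\<delta> * ?N) * \<rho> ^ n"
        unfolding \<rho>_def using assms(3,4) by (intro merw_axis_count_tail[OF assms(5)]) auto
      also have "2 powr (\<delta> * ?N) = (1 / s) ^ Suc n"
        using \<delta>(2) by (simp only: powr_powr[symmetric]) (subst powr_realpow; use s in simp)
      also have "(1 / s) ^ Suc n * \<rho> ^ n = 1 / s * s ^ n"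
        using s by (simp add: power_divide power_mult_distrib)
      finally show "prob (?few i) \<le> 1 / s * s ^ n" .
    qed
    also have "\<dots> = real ?d * (1 / s * s ^ n)" by simp
    also have "prob ?many \<le> (7 * (?N powr \<nu> + 1) / sqrt ?L) ^ ?d"
      using \<delta>(1) by (intro coupled_small_ball[OF _ _ assms(7)]) auto
    also have "\<dots> \<le> (14 / sqrt \<delta> * ?N powr (\<nu> - 1 / 2)) ^ ?d"
    proof (rule power_mono)
      have "1 \<le> ?N powr \<nu>"
        using assms(8) by (intro ge_one_powr_ge_zero) auto
      then have "7 * (?N powr \<nu> + 1) / sqrt ?L \<le> 14 * ?N powr \<nu> / sqrt ?L"
        using \<delta>(1) by (intro divide_right_mono) auto
      also have "\<dots> = 14 / sqrt \<delta> * ?N powr (\<nu> - 1 / 2)"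
        by (simp add: real_sqrt_mult powr_diff powr_half_sqrt)
      finally show "7 * (?N powr \<nu> + 1) / sqrt ?L \<le> 14 / sqrt \<delta> * ?N powr (\<nu> - 1 / 2)" .
    qed (use \<delta>(1) in simp)
    also have "\<dots> = (14 / sqrt \<delta>) ^ ?d * ?N powr e"
    proof -
      have "(?N powr (\<nu> - 1 / 2)) ^ ?d = ?N powr e"
        unfolding e_def by (simp add: powr_powr flip: powr_realpow)
      then show ?thesis by (simp only: power_mult_distrib)
    qed
    finally show ?thesis by (simp add: b_def)
  qed
  have "summable b"
    unfolding b_def
  proof (intro summable_add summable_mult summable_geometric)
    show "summable (\<lambda>n. real (Suc n) powr e)"
      using e by (subst summable_Suc_iff) (simp add: summable_real_powr_iff)
  qed (use s in auto)
  have b_nonneg: "0 \<le> b n" for n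
    using bound[of n] measure_nonneg order_trans by blast

  have "?IT = (\<Sum>n. \<integral>\<^sup>+ \<omega>. indicator (?smallT n) \<omega> \<partial>M)"
    by (intro nn_integral_suminf meas T_meas)
  also have "\<dots> \<le> (\<Sum>n. ennreal (b n))"
  proof (intro suminf_le)
    fix n
    have "(\<integral>\<^sup>+ \<omega>. indicator (?smallT n) \<omega> \<partial>M)
        = (\<integral>\<^sup>+ \<omega>. indicator {\<omega> \<in> space M. norm (T (Suc n) \<omega>) \<le> real (Suc n) powr \<nu>} \<omega> \<partial>M)"
      by (intro nn_integral_cong) (auto simp: indicator_def)
    also have "\<dots> = ennreal (prob {\<omega> \<in> space M. norm (T (Suc n) \<omega>) \<le> real (Suc n) powr \<nu>})"
      by (simp add: emeasure_eq_measure)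
    also have "\<dots> \<le> ennreal (b n)"
      by (intro ennreal_leI bound)
    finally show "(\<integral>\<^sup>+ \<omega>. indicator (?smallT n) \<omega> \<partial>M) \<le> ennreal (b n)" .
  qed auto
  also have "\<dots> < \<infinity>"
    using ennreal_suminf_neq_top[OF \<open>summable b\<close> b_nonneg] by (simp add: less_top)
  finally have finite: "?IT < \<infinity>" .

  have "AE \<omega> in M. (\<Sum>n. indicator (?smallS n) \<omega> :: ennreal) \<noteq> \<infinity>"
    using le finite by (intro nn_integral_PInf_AE borel_measurable_suminf_order meas S_meas) auto
  then have "AE \<omega> in M. eventually (\<lambda>n. norm (S n \<omega>) > real n powr \<nu>) sequentially"
  proof eventually_elim
    case (elim \<omega>)
    have "summable (\<lambda>n. indicator (?smallS n) \<omega> :: real)"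
    proof (rule summable_suminf_not_top)
      show "(\<Sum>n. ennreal (indicator (?smallS n) \<omega>)) \<noteq> \<top>"
        using elim by (simp add: ennreal_indicator)
    qed simp
    then have "(\<lambda>n. indicator (?smallS n) \<omega> :: real) \<longlonglongrightarrow> 0"
      by (rule summable_LIMSEQ_zero)
    then have "eventually (\<lambda>n. indicator (?smallS n) \<omega> < (1 :: real)) sequentially"
      by (rule order_tendstoD) simp
    then have "eventually (\<lambda>n. norm (S (Suc n) \<omega>) > real (Suc n) powr \<nu>) sequentially"
      by eventually_elim (auto simp: indicator_def split: if_splits)
    then show ?case
      by (subst (asm) eventually_sequentially_Suc)
  qed
  with le finite show ?thesis by blast
qed

end
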